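(* Let $W$ be a finite reflection group with fundamental chamber $B$, let $\mathbf{a}\in B$, and let $\{\mathcal{S}_i\}_{i=1}^p$ be an $\mathbf{a}$-triangulation. Then $\{\mathcal{S}_i\}_{i=1}^p$ is a persistent triangulation if and only if every $\mathcal{S}_i$ is a persistent simplex.
   Context: $W$ is a finite group generated by orthogonal reflections of a Euclidean space $V$, with root system $\Phi$; $B$ is a fixed open chamber, i.e. a connected component of the complement of the hyperplanes $\alpha^\perp$, $\alpha\in\Phi$. For $\mathbf{a}\in B$ put $P^W(\mathbf{a})=\mathrm{conv}(W\cdot\mathbf{a})$; its vertices are the points $w\cdot\mathbf{a}$, labeled bijectively by $w\in W$. Let $d=\dim P^W(\mathbf{a})$ (this does not depend on $\mathbf{a}\in B$). Definitions. A subset $\mathcal{S}\subseteq W$ of size $d+1$ is an $\mathbf{a}$-simplex if $\mathrm{conv}(\mathcal{S}\cdot\mathbf{a})$ is a $d$-dimensional simplex. A collection $\{\mathcal{S}_i\}_{i=1}^p$ of $\mathbf{a}$-simplices is an $\mathbf{a}$-triangulation if $\{\mathrm{conv}(\mathcal{S}_i\cdot\mathbf{a})\}_{i=1}^p$ is a triangulation of $P^W(\mathbf{a})$, i.e. $P^W(\mathbf{a})=\bigcup_i\mathrm{conv}(\mathcal{S}_i\cdot\mathbf{a})$ and for all $i,j$ the simplices $\mathrm{conv}(\mathcal{S}_i\cdot\mathbf{a})$ and $\mathrm{conv}(\mathcal{S}_j\cdot\mathbf{a})$ intersect in a common (possibly empty) face. A subset $\mathcal{S}\subseteq W$ of size $d+1$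 is a persistent simplex if it is an $\mathbf{a}'$-simplex for every $\mathbf{a}'\in B$. A collection $\{\mathcal{S}_i\}$ of persistent simplices is a persistent triangulation if it is an $\mathbf{a}'$-triangulation for every $\mathbf{a}'\in B$. *)

theory Defs
  imports "HOL-Analysis.Analysis" "HOL-Algebra.Bij" "HOL-Algebra.Generated_Groups"
begin

definition reflection :: "'v::euclidean_space \<Rightarrow> 'v \<Rightarrow> 'v" where
  "reflection \<alpha> x = x - (2 * (x \<bullet> \<alpha>) / (\<alpha> \<bullet> \<alpha>)) *\<^sub>R \<alpha>"

text \<open>Reduced, not necessarily crystallographic, and not required to span the space.\<close>

definition root_system :: "'v::euclidean_space set \<Rightarrow> bool" where
  "root_system \<Phi> \<longleftrightarrow> finite \<Phi> \<and> 0 \<notin> \<Phi> \<and>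
     (\<forall>\<alpha>\<in>\<Phi>. \<Phi> \<inter> span {\<alpha>} = {\<alpha>, - \<alpha>}) \<and>
     (\<forall>\<alpha>\<in>\<Phi>. reflection \<alpha> ` \<Phi> = \<Phi>)"

text \<open>Group elements are maps of the ambient space, composed in \<open>BijGroup UNIV\<close>.\<close>

definition finite_reflection_group ::
  "('v::euclidean_space \<Rightarrow> 'v) set \<Rightarrow> 'v set \<Rightarrow> bool" where
  "finite_reflection_group W \<Phi> \<longleftrightarrow>
     finite W \<and> root_system \<Phi> \<and> W = generate (BijGroup UNIV) (reflection ` \<Phi>)"

definition open_chamber :: "'v::euclidean_space set \<Rightarrow> 'v set \<Rightarrow> bool" where
  "open_chamber \<Phi> B \<longleftrightarrow> B \<in> components (- (\<Union>\<alpha>\<in>\<Phi>. {x. \<alpha> \<bullet> x = 0}))"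

definition orbit_points :: "('v \<Rightarrow> 'v) set \<Rightarrow> 'v \<Rightarrow> 'v set" where
  "orbit_points S a = (\<lambda>w. w a) ` S"

definition permutohedron :: "('v::euclidean_space \<Rightarrow> 'v) set \<Rightarrow> 'v \<Rightarrow> 'v set" where
  "permutohedron W a = convex hull (orbit_points W a)"

text \<open>The dimension \<open>d\<close> is read off from the polytope of the given point \<open>a\<close>; it is the same for
  all points of a chamber.\<close>

definition a_simplex ::
  "('v::euclidean_space \<Rightarrow> 'v) set \<Rightarrow> 'v \<Rightarrow> ('v \<Rightarrow> 'v) set \<Rightarrow> bool" where
  "a_simplex W a S \<longleftrightarrow> S \<subseteq> W \<and>
     int (card S) = aff_dim (permutohedron W a) + 1 \<and>
     aff_dim (permutohedron W a) simplex (convex hull (orbit_points S a))"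

text \<open>\<open>triangulation\<close> asks that \<open>T \<inter> T'\<close> be a face of \<open>T\<close> for all ordered pairs, hence a common,
  possibly empty, face; covering the polytope is a separate condition.\<close>

definition a_triangulation ::
  "('v::euclidean_space \<Rightarrow> 'v) set \<Rightarrow> 'v \<Rightarrow> 'i set \<Rightarrow> ('i \<Rightarrow> ('v \<Rightarrow> 'v) set) \<Rightarrow> bool" where
  "a_triangulation W a I S \<longleftrightarrow>
     (\<forall>i\<in>I. a_simplex W a (S i)) \<and>
     triangulation ((\<lambda>i. convex hull (orbit_points (S i) a)) ` I) \<and>
     permutohedron W a = (\<Union>i\<in>I. convex hull (orbit_points (S i) a))"

definition persistent_simplex ::
  "('v::euclidean_space \<Rightarrow> 'v) set \<Rightarrow> 'v set \<Rightarrow> ('v \<Rightarrow> 'v) set \<Rightarrow> bool" where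
  "persistent_simplex W B S \<longleftrightarrow> (\<forall>a'\<in>B. a_simplex W a' S)"

definition persistent_triangulation ::
  "('v::euclidean_space \<Rightarrow> 'v) set \<Rightarrow> 'v set \<Rightarrow> 'i set \<Rightarrow> ('i \<Rightarrow> ('v \<Rightarrow> 'v) set) \<Rightarrow> bool" where
  "persistent_triangulation W B I S \<longleftrightarrow>
     (\<forall>i\<in>I. persistent_simplex W B (S i)) \<and> (\<forall>a'\<in>B. a_triangulation W a' I S)"

end

theory Submission
  imports Defs
begin

text \<open>
  One direction is part of the definition of a persistent triangulation. For the other, consider
  the set of those points \<open>b\<close> of the chamber \<open>B\<close> for which the given simplices, with their
  vertices \<open>w b\<close>, triangulate the permutohedron of \<open>b\<close>. It contains \<open>a\<close>, and \<open>B\<close> is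
  connected, so it suffices that this set is open and closed in \<open>B\<close>.

  The tool for both is the transition map between the positions at two points \<open>b\<close> and \<open>b'\<close>: when
  the simplices triangulate the permutohedron of \<open>b\<close>, the affine maps that send the vertices
  \<open>w b\<close> of a simplex to \<open>w b'\<close> fit together to a continuous map \<open>f\<close> between the two
  permutohedra, and the simplices triangulate the permutohedron of \<open>b'\<close> exactly when \<open>f\<close> is
  bijective.

  Openness: the barycentric coordinates of a triangulation are Lipschitz, so for \<open>b'\<close> near
  \<open>b\<close> the map \<open>f\<close> differs from the identity by a map of small Lipschitz constant, and is
  injective (\<open>transition_injective\<close>). It sends boundary points to boundary points
  (\<open>transition_boundary\<close>), because the labels \<open>w\<close> for which \<open>w b\<close> maximises a given linear
  functional do not depend on the point of the chamber (\<open>chamber_maximal_transfer\<close>). By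
  invariance of domain, an injection that preserves the boundary is onto
  (\<open>boundary_preserving_injection_onto\<close>).

  Closedness: the map \<open>f\<close> to a limit position is a uniform limit of embeddings onto convex sets.
  Fibres of such a limit are connected, and here they are finite, as the simplices are still
  nondegenerate in the limit position; so \<open>f\<close> is injective
  (\<open>limit_of_convex_embeddings_inj\<close>). It is onto by compactness.

  Two facts about the group are needed: the independence of the maximising labels just mentioned,
  and freeness of the action on the chamber (\<open>chamber_action_free\<close>), by which a vertex determines
  its label. Both follow from the deletion property of words in simple reflections
  (\<open>reduced_simple_word\<close>).
\<close>


section \<open>Reflections and words in reflections\<close>

lemma linear_reflection: "linear (reflection \<alpha>)"
  by (rule linearI)
    (auto simp: reflection_def algebra_simps inner_left_distrib add_divide_distrib)

lemma reflection_self: "\<alpha> \<noteq> 0 \<Longrightarrow> reflection \<alpha> \<alpha> = - \<alpha>"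
  by (simp add: reflection_def scaleR_2)

lemma reflection_minus: "reflection (- \<alpha>) = reflection \<alpha>"
  by (simp add: reflection_def fun_eq_iff)

lemma reflection_inner: "reflection \<alpha> x \<bullet> reflection \<alpha> y = x \<bullet> y"
  by (cases "\<alpha> = 0") (simp_all add: reflection_def inner_commute algebra_simps)

lemma reflection_reflection: "reflection \<alpha> (reflection \<alpha> x) = x"
  by (cases "\<alpha> = 0") (simp_all add: reflection_def algebra_simps)

lemma orthogonal_reflection: "orthogonal_transformation (reflection \<alpha>)"
  by (simp add: orthogonal_transformation_def linear_reflection reflection_inner)

lemma reflection_conjugate:
  assumes "orthogonal_transformation g"
  shows "reflection (g \<alpha>) (g x) = g (reflection \<alpha> x)"
proof -
  have "linear g" "g x \<bullet> g \<alpha> = x \<bullet> \<alpha>" "g \<alpha> \<bullet> g \<alpha> = \<alpha> \<bullet> \<alpha>"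
    using assms by (auto simp: orthogonal_transformation_def)
  then show ?thesis
    by (simp add: reflection_def linear_diff linear_cmul)
qed

primrec refl_word :: "'v::euclidean_space list \<Rightarrow> 'v \<Rightarrow> 'v" where
  "refl_word [] = (\<lambda>x. x)"
| "refl_word (\<alpha> # l) = (\<lambda>x. reflection \<alpha> (refl_word l x))"

lemma refl_word_append: "refl_word (l @ m) x = refl_word l (refl_word m x)"
  by (induction l) auto

lemma refl_word_rev: "refl_word (rev l) (refl_word l x) = x"
  by (induction l arbitrary: x) (auto simp: refl_word_append reflection_reflection)

lemma orthogonal_refl_word: "orthogonal_transformation (refl_word l)"
proof (induction l)
  case Nil
  then show ?case by (simp add: orthogonal_transformation_def linear_iff)
next
  case (Cons \<alpha> l)
  then show ?case
    using orthogonal_transformation_compose[OF orthogonal_reflection[of \<alpha>] Cons]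
    by (simp add: o_def)
qed

lemma refl_word_inner: "refl_word l x \<bullet> refl_word l y = x \<bullet> y"
  using orthogonal_refl_word[of l] by (simp add: orthogonal_transformation_def)

lemma refl_word_inner_rev: "x \<bullet> refl_word l y = refl_word (rev l) x \<bullet> y"
  using refl_word_inner[of "rev l" x "refl_word l y"] by (simp add: refl_word_rev)

lemma linear_refl_word: "linear (refl_word l)"
  using orthogonal_refl_word orthogonal_transformation_linear by blast

lemma reflection_in_Bij: "reflection \<alpha> \<in> Bij UNIV"
proof -
  have "bij (reflection \<alpha>)"
    by (rule involuntory_imp_bij) (rule reflection_reflection)
  then show ?thesis by (simp add: Bij_def)
qed

lemma refl_word_in_Bij: "refl_word l \<in> Bij UNIV"
  using orthogonal_transformation_bij[OF orthogonal_refl_word[of l]] by (simp add: Bij_def)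

text \<open>Reflections are their own inverses, so the group that they generate consists of
  words.\<close>

lemma generate_reflections:
  "generate (BijGroup UNIV) (reflection ` \<Phi>) = refl_word ` lists \<Phi>"
proof -
  have mult: "f \<otimes>\<^bsub>BijGroup UNIV\<^esub> g = f \<circ> g" if "f \<in> Bij UNIV" "g \<in> Bij UNIV" for f g :: "'a \<Rightarrow> 'a"
    using that by (simp add: BijGroup_def compose_def o_def restrict_def)
  have inv: "inv\<^bsub>BijGroup UNIV\<^esub> (reflection \<alpha>) = reflection \<alpha>" for \<alpha> :: 'a
  proof (rule group.inv_equality[OF group_BijGroup])
    have "reflection \<alpha> \<circ> reflection \<alpha> = (\<lambda>x. x)"
      by (auto simp: reflection_reflection)
    then show "reflection \<alpha> \<otimes>\<^bsub>BijGroup UNIV\<^esub> reflection \<alpha> = \<one>\<^bsub>BijGroup UNIV\<^esub>"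
      using mult[OF reflection_in_Bij reflection_in_Bij] by (simp add: BijGroup_def restrict_def)
  qed (simp_all add: BijGroup_def reflection_in_Bij)
  have word1: "reflection \<alpha> \<in> refl_word ` lists \<Phi>" if "\<alpha> \<in> \<Phi>" for \<alpha>
    using that by (intro image_eqI[of _ _ "[\<alpha>]"]) auto
  show ?thesis
  proof (intro equalityI subsetI)
    fix w assume "w \<in> generate (BijGroup UNIV) (reflection ` \<Phi>)"
    then show "w \<in> refl_word ` lists \<Phi>"
    proof induction
      case one
      show ?case by (intro image_eqI[of _ _ "[]"]) (auto simp: BijGroup_def)
    next
      case (incl h)
      then show ?case using word1 by auto
    next
      case (inv h)
      then show ?case using word1 \<open>\<And>\<alpha>. inv\<^bsub>BijGroup UNIV\<^esub> (reflection \<alpha>) = reflection \<alpha>\<close> by auto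
    next
      case (eng h1 h2)
      then obtain l m where lm: "l \<in> lists \<Phi>" "m \<in> lists \<Phi>" "h1 = refl_word l" "h2 = refl_word m"
        by auto
      then have "h1 \<otimes>\<^bsub>BijGroup UNIV\<^esub> h2 = refl_word (l @ m)"
        by (auto simp: mult refl_word_in_Bij refl_word_append)
      then show ?case using lm by auto
    qed
  next
    fix w assume "w \<in> refl_word ` lists \<Phi>"
    then obtain l where "l \<in> lists \<Phi>" "w = refl_word l" by auto
    moreover have "refl_word l \<in> generate (BijGroup UNIV) (reflection ` \<Phi>)" if "l \<in> lists \<Phi>" for l
      using that
    proof (induction l)
      case Nil
      have "\<one>\<^bsub>BijGroup UNIV\<^esub> = refl_word ([] :: 'a list)"
        by (auto simp: BijGroup_def)
      then show ?case
        using generate.one[of "BijGroup UNIV" "reflection ` \<Phi>"] by simp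
    next
      case (Cons \<alpha> l)
      then have "reflection \<alpha> \<in> reflection ` \<Phi>" by simp
      from generate.eng[OF generate.incl[OF this] Cons.IH]
      have "reflection \<alpha> \<otimes>\<^bsub>BijGroup UNIV\<^esub> refl_word l \<in> generate (BijGroup UNIV) (reflection ` \<Phi>)" .
      then show ?case
        by (simp add: mult reflection_in_Bij refl_word_in_Bij o_def)
    qed
    ultimately show "w \<in> generate (BijGroup UNIV) (reflection ` \<Phi>)" by simp
  qed
qed

section \<open>Positive and simple roots\<close>

locale regular_vector =
  fixes \<Phi> :: "'v::euclidean_space set" and b :: 'v
  assumes root_system: "root_system \<Phi>"
    and regular: "\<And>\<alpha>. \<alpha> \<in> \<Phi> \<Longrightarrow> \<alpha> \<bullet> b \<noteq> 0"
begin

definition positive :: "'v set" where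
  "positive = {\<alpha> \<in> \<Phi>. 0 < \<alpha> \<bullet> b}"

text \<open>Simple roots are singled out by how their reflections permute the positive roots, since this
  is what controls signs along a word of simple reflections. That there are enough of them is
  shown in \<open>ex_simple_acute\<close>.\<close>

definition simple :: "'v set" where
  "simple = {\<alpha> \<in> positive. \<forall>\<beta>\<in>positive. \<beta> \<noteq> \<alpha> \<longrightarrow> reflection \<alpha> \<beta> \<in> positive}"

definition dominant :: "'v \<Rightarrow> bool" where
  "dominant x \<longleftrightarrow> (\<forall>\<alpha>\<in>positive. 0 \<le> x \<bullet> \<alpha>)"

lemma finite_positive: "finite positive"
  using root_system by (simp add: root_system_def positive_def)

lemma positive_root: "\<alpha> \<in> positive \<Longrightarrow> \<alpha> \<in> \<Phi>"
  by (simp add: positive_def)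

lemma simple_positive: "\<alpha> \<in> simple \<Longrightarrow> \<alpha> \<in> positive"
  by (simp add: simple_def)

lemma root_nonzero: "\<alpha> \<in> \<Phi> \<Longrightarrow> \<alpha> \<noteq> 0"
  using root_system by (auto simp: root_system_def)

lemma root_multiple: "\<alpha> \<in> \<Phi> \<Longrightarrow> c *\<^sub>R \<alpha> \<in> \<Phi> \<Longrightarrow> c *\<^sub>R \<alpha> = \<alpha> \<or> c *\<^sub>R \<alpha> = - \<alpha>"
  using root_system span_base[of \<alpha> "{\<alpha>}"] unfolding root_system_def
  by (metis Int_iff insertE singletonD singletonI span_mul)

lemma reflection_root: "\<alpha> \<in> \<Phi> \<Longrightarrow> \<beta> \<in> \<Phi> \<Longrightarrow> reflection \<alpha> \<beta> \<in> \<Phi>"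
  using root_system by (auto simp: root_system_def)

lemma minus_root: "\<alpha> \<in> \<Phi> \<Longrightarrow> - \<alpha> \<in> \<Phi>"
  using reflection_root[of \<alpha> \<alpha>] reflection_self[OF root_nonzero] by auto

lemma not_positive_iff: "\<alpha> \<in> \<Phi> \<Longrightarrow> \<alpha> \<notin> positive \<longleftrightarrow> - \<alpha> \<in> positive"
  using regular[of \<alpha>] minus_root[of \<alpha>] by (auto simp: positive_def)

lemma refl_word_root: "l \<in> lists \<Phi> \<Longrightarrow> \<beta> \<in> \<Phi> \<Longrightarrow> refl_word l \<beta> \<in> \<Phi>"
  by (induction l) (auto simp: reflection_root)

lemma simple_words: "l \<in> lists simple \<Longrightarrow> l \<in> lists \<Phi>"
  using simple_positive positive_root by blast

text \<open>The cone spanned by the positive roots is also spanned by some set of them of least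
  cardinality, and minimality forces the elements of such a set to be simple: if the reflection
  in one of them, \<open>\<alpha>\<close>, made a positive \<open>\<beta> \<noteq> \<alpha>\<close> negative, a multiple of \<open>\<alpha>\<close> would
  be a sum of two positive roots, and \<open>\<alpha>\<close> would lie in the cone of the other elements. Having
  nonpositive inner product with a spanning set of the cone is impossible for a nonzero
  vector of the cone.\<close>

lemma ex_simple_acute:
  assumes "\<beta> \<in> positive"
  shows "\<exists>\<alpha>\<in>simple. 0 < \<alpha> \<bullet> \<beta>"
proof -
  define spans where "spans D \<longleftrightarrow> D \<subseteq> positive \<and>
    (\<forall>\<beta>\<in>positive. \<exists>c. (\<forall>\<delta>. 0 \<le> c \<delta>) \<and> \<beta> = (\<Sum>\<delta>\<in>D. c \<delta> *\<^sub>R \<delta>))" for D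
  have "spans positive"
    unfolding spans_def
  proof (intro conjI ballI)
    fix \<beta> assume "\<beta> \<in> positive"
    then have "\<beta> = (\<Sum>\<delta>\<in>positive. (if \<delta> = \<beta> then 1 else 0) *\<^sub>R \<delta>)"
      using finite_positive by (simp add: if_distrib[of "\<lambda>t. t *\<^sub>R _"] sum.delta cong: if_cong)
    then show "\<exists>c. (\<forall>\<delta>. 0 \<le> c \<delta>) \<and> \<beta> = (\<Sum>\<delta>\<in>positive. c \<delta> *\<^sub>R \<delta>)"
      by (intro exI[of _ "\<lambda>\<delta>. if \<delta> = \<beta> then 1 else 0"]) auto
  qed simp
  then obtain D where D: "spans D" and least: "\<And>E. spans E \<Longrightarrow> card D \<le> card E"
    using ex_has_least_nat[of spans positive card] by blast
  have DP: "D \<subseteq> positive" and fin: "finite D"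
    using D finite_positive finite_subset unfolding spans_def by auto
  have irredundant: False
    if \<alpha>: "\<alpha> \<in> D" and e: "\<And>\<delta>. 0 \<le> e \<delta>" and eq: "\<alpha> = (\<Sum>\<delta>\<in>D - {\<alpha>}. e \<delta> *\<^sub>R \<delta>)" for \<alpha> e
  proof -
    have "spans (D - {\<alpha>})"
      unfolding spans_def
    proof (intro conjI ballI)
      fix \<beta> assume "\<beta> \<in> positive"
      then obtain c where c: "\<And>\<delta>. 0 \<le> c \<delta>" and \<beta>: "\<beta> = (\<Sum>\<delta>\<in>D. c \<delta> *\<^sub>R \<delta>)"
        using D unfolding spans_def by blast
      have "\<beta> = c \<alpha> *\<^sub>R \<alpha> + (\<Sum>\<delta>\<in>D - {\<alpha>}. c \<delta> *\<^sub>R \<delta>)"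
        unfolding \<beta> using sum.remove[OF fin \<alpha>] by simp
      also have "\<dots> = c \<alpha> *\<^sub>R (\<Sum>\<delta>\<in>D - {\<alpha>}. e \<delta> *\<^sub>R \<delta>) + (\<Sum>\<delta>\<in>D - {\<alpha>}. c \<delta> *\<^sub>R \<delta>)"
        using eq by simp
      also have "\<dots> = (\<Sum>\<delta>\<in>D - {\<alpha>}. (c \<alpha> * e \<delta> + c \<delta>) *\<^sub>R \<delta>)"
        by (simp add: scaleR_sum_right sum.distrib algebra_simps)
      finally show "\<exists>c. (\<forall>\<delta>. 0 \<le> c \<delta>) \<and> \<beta> = (\<Sum>\<delta>\<in>D - {\<alpha>}. c \<delta> *\<^sub>R \<delta>)"
        using c e by (intro exI[of _ "\<lambda>\<delta>. c \<alpha> * e \<delta> + c \<delta>"]) auto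
    qed (use DP in auto)
    then show False
      using least card_Diff1_less[OF fin \<alpha>] by fastforce
  qed
  have "D \<subseteq> simple"
  proof
    fix \<alpha> assume \<alpha>: "\<alpha> \<in> D"
    have \<alpha>pos: "\<alpha> \<in> positive" using \<alpha> DP by auto
    have "reflection \<alpha> \<beta> \<in> positive" if \<beta>: "\<beta> \<in> positive" "\<beta> \<noteq> \<alpha>" for \<beta>
    proof (rule ccontr)
      assume "reflection \<alpha> \<beta> \<notin> positive"
      then have \<gamma>: "- reflection \<alpha> \<beta> \<in> positive"
        using not_positive_iff reflection_root \<alpha>pos \<beta> positive_root by blast
      define k where "k = 2 * (\<beta> \<bullet> \<alpha>) / (\<alpha> \<bullet> \<alpha>)"
      obtain c where c: "\<And>\<delta>. 0 \<le> c \<delta>" and \<beta>c: "\<beta> = (\<Sum>\<delta>\<in>D. c \<delta> *\<^sub>R \<delta>)"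
        using D \<beta> unfolding spans_def by blast
      obtain d where d: "\<And>\<delta>. 0 \<le> d \<delta>" and \<gamma>d: "- reflection \<alpha> \<beta> = (\<Sum>\<delta>\<in>D. d \<delta> *\<^sub>R \<delta>)"
        using D \<gamma> unfolding spans_def by blast
      have "k *\<^sub>R \<alpha> = \<beta> + - reflection \<alpha> \<beta>"
        by (simp add: reflection_def k_def)
      also have "\<dots> = (\<Sum>\<delta>\<in>D. (c \<delta> + d \<delta>) *\<^sub>R \<delta>)"
        unfolding \<gamma>d by (subst \<beta>c) (simp add: sum.distrib algebra_simps)
      also have "\<dots> = (c \<alpha> + d \<alpha>) *\<^sub>R \<alpha> + (\<Sum>\<delta>\<in>D - {\<alpha>}. (c \<delta> + d \<delta>) *\<^sub>R \<delta>)"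
        using sum.remove[OF fin \<alpha>] by simp
      finally have rel: "(k - c \<alpha> - d \<alpha>) *\<^sub>R \<alpha> = (\<Sum>\<delta>\<in>D - {\<alpha>}. (c \<delta> + d \<delta>) *\<^sub>R \<delta>)"
        by (simp add: algebra_simps)
      define m where "m = k - c \<alpha> - d \<alpha>"
      show False
      proof (cases "0 < m")
        case True
        have "\<alpha> = inverse m *\<^sub>R (m *\<^sub>R \<alpha>)" using True by simp
        also have "\<dots> = (\<Sum>\<delta>\<in>D - {\<alpha>}. (inverse m * (c \<delta> + d \<delta>)) *\<^sub>R \<delta>)"
          using rel by (simp add: m_def scaleR_sum_right)
        finally show False
          using irredundant[OF \<alpha>, of "\<lambda>\<delta>. inverse m * (c \<delta> + d \<delta>)"] c d True by simp
      next
        \<comment> \<open>Pairing the relation with \<open>b\<close> gives a sum of nonnegative terms that is at most \<open>0\<close>,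
          so all terms vanish and \<open>\<beta>\<close> is a multiple of \<open>\<alpha>\<close>.\<close>
        case False
        have nn: "0 \<le> (c \<delta> + d \<delta>) * (\<delta> \<bullet> b)" if "\<delta> \<in> D - {\<alpha>}" for \<delta>
          using that DP c[of \<delta>] d[of \<delta>] by (auto simp: positive_def intro!: mult_nonneg_nonneg)
        have "(\<Sum>\<delta>\<in>D - {\<alpha>}. (c \<delta> + d \<delta>) * (\<delta> \<bullet> b)) = m * (\<alpha> \<bullet> b)"
          using arg_cong[OF rel, of "\<lambda>x. x \<bullet> b"] by (simp add: inner_sum_left m_def)
        also have "\<dots> \<le> 0"
          using False \<alpha>pos by (auto simp: positive_def mult_nonpos_nonneg)
        finally have le: "(\<Sum>\<delta>\<in>D - {\<alpha>}. (c \<delta> + d \<delta>) * (\<delta> \<bullet> b)) \<le> 0" .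
        have "0 \<le> (\<Sum>\<delta>\<in>D - {\<alpha>}. (c \<delta> + d \<delta>) * (\<delta> \<bullet> b))"
          by (intro sum_nonneg nn)
        with le have "(\<Sum>\<delta>\<in>D - {\<alpha>}. (c \<delta> + d \<delta>) * (\<delta> \<bullet> b)) = 0"
          by simp
        then have "\<forall>\<delta>\<in>D - {\<alpha>}. (c \<delta> + d \<delta>) * (\<delta> \<bullet> b) = 0"
          using sum_nonneg_eq_0_iff[of "D - {\<alpha>}" "\<lambda>\<delta>. (c \<delta> + d \<delta>) * (\<delta> \<bullet> b)"] nn fin
          by auto
        then have "c \<delta> = 0" if "\<delta> \<in> D - {\<alpha>}" for \<delta>
          using that DP c[of \<delta>] d[of \<delta>] by (force simp: positive_def)
        then have "\<beta> = c \<alpha> *\<^sub>R \<alpha>"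
          using \<beta>c sum.remove[OF fin \<alpha>, of "\<lambda>\<delta>. c \<delta> *\<^sub>R \<delta>"] by simp
        then have "\<beta> = - \<alpha>"
          using root_multiple[of \<alpha> "c \<alpha>"] \<beta> \<alpha>pos positive_root by auto
        then show False
          using not_positive_iff[of \<alpha>] \<beta> \<alpha>pos positive_root by auto
      qed
    qed
    then show "\<alpha> \<in> simple"
      using \<alpha>pos by (simp add: simple_def)
  qed
  obtain c where c: "\<And>\<delta>. 0 \<le> c \<delta>" and \<beta>c: "\<beta> = (\<Sum>\<delta>\<in>D. c \<delta> *\<^sub>R \<delta>)"
    using D assms unfolding spans_def by blast
  have "\<exists>\<delta>\<in>D. 0 < \<delta> \<bullet> \<beta>"
  proof (rule ccontr)
    assume "\<not> ?thesis"
    then have "(\<Sum>\<delta>\<in>D. c \<delta> * (\<delta> \<bullet> \<beta>)) \<le> 0"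
      using c by (intro sum_nonpos mult_nonneg_nonpos) auto
    moreover have "\<beta> \<bullet> \<beta> = (\<Sum>\<delta>\<in>D. c \<delta> * (\<delta> \<bullet> \<beta>))"
      by (subst (1) \<beta>c) (simp add: inner_sum_left)
    ultimately show False
      using root_nonzero[OF positive_root[OF assms]] inner_gt_zero_iff[of \<beta>] by linarith
  qed
  then show ?thesis using \<open>D \<subseteq> simple\<close> by auto
qed

text \<open>A positive root that is not simple is brought closer to the hyperplane orthogonal to \<open>b\<close>
  by a simple reflection, and stays positive. The induction conjugates its reflection down to a
  simple one.\<close>

lemma reflection_as_simple_word:
  assumes "\<beta> \<in> positive"
  shows "\<exists>l\<in>lists simple. refl_word l = reflection \<beta>"
  using assms
proof (induction "card {\<gamma> \<in> positive. \<gamma> \<bullet> b < \<beta> \<bullet> b}" arbitrary: \<beta> rule: less_induct)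
  case less
  show ?case
  proof (cases "\<beta> \<in> simple")
    case True
    then show ?thesis by (intro bexI[of _ "[\<beta>]"]) auto
  next
    case False
    obtain \<alpha> where \<alpha>: "\<alpha> \<in> simple" "0 < \<alpha> \<bullet> \<beta>"
      using ex_simple_acute less.prems by blast
    define \<gamma> where "\<gamma> = reflection \<alpha> \<beta>"
    have "\<beta> \<noteq> \<alpha>" using \<alpha> False by auto
    then have \<gamma>: "\<gamma> \<in> positive"
      using \<alpha> less.prems unfolding simple_def \<gamma>_def by auto
    have \<alpha>pos: "0 < \<alpha> \<bullet> b" "0 < \<alpha> \<bullet> \<alpha>"
      using \<alpha> root_nonzero[of \<alpha>] by (auto simp: simple_def positive_def)
    have "0 < (2 * (\<beta> \<bullet> \<alpha>) / (\<alpha> \<bullet> \<alpha>)) * (\<alpha> \<bullet> b)"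
      using \<alpha>pos \<alpha> by (simp add: inner_commute)
    then have lt: "\<gamma> \<bullet> b < \<beta> \<bullet> b"
      by (simp add: \<gamma>_def reflection_def inner_diff_left)
    have "card {\<delta> \<in> positive. \<delta> \<bullet> b < \<gamma> \<bullet> b} < card {\<delta> \<in> positive. \<delta> \<bullet> b < \<beta> \<bullet> b}"
      using finite_positive lt \<gamma> by (intro psubset_card_mono) auto
    then obtain l where l: "l \<in> lists simple" "refl_word l = reflection \<gamma>"
      using less.hyps \<gamma> by blast
    have "refl_word (\<alpha> # l @ [\<alpha>]) x = reflection \<beta> x" for x
      using reflection_conjugate[OF orthogonal_reflection[of \<alpha>], of \<gamma> "reflection \<alpha> x"] l
      by (simp add: refl_word_append \<gamma>_def reflection_reflection)
    then show ?thesis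
      using l \<alpha> by (intro bexI[of _ "\<alpha> # l @ [\<alpha>]"]) auto
  qed
qed

lemma word_as_simple_word:
  assumes "l \<in> lists \<Phi>"
  shows "\<exists>m\<in>lists simple. refl_word m = refl_word l"
  using assms
proof (induction l)
  case Nil
  show ?case by (intro bexI[of _ "[]"]) auto
next
  case (Cons \<alpha> l)
  have "\<alpha> \<in> positive \<or> - \<alpha> \<in> positive"
    using not_positive_iff Cons.hyps by blast
  then obtain k where k: "k \<in> lists simple" "refl_word k = reflection \<alpha>"
    using reflection_as_simple_word reflection_minus by metis
  obtain m where m: "m \<in> lists simple" "refl_word m = refl_word l"
    using Cons by auto
  show ?case
    using k m by (intro bexI[of _ "k @ m"]) (auto simp: refl_word_append fun_eq_iff)
qed

text \<open>When the letters of the word are applied one after the other to \<open>\<alpha>\<close>, some letter makes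
  the root change from positive to negative; a simple reflection does this to its own root
  only.\<close>

lemma sign_change_letter:
  assumes "l \<in> lists simple" "\<alpha> \<in> positive" "refl_word l \<alpha> \<notin> positive"
  shows "\<exists>l1 l2. l = l1 @ refl_word l2 \<alpha> # l2"
  using assms
proof (induction l)
  case (Cons \<gamma> l2)
  show ?case
  proof (cases "refl_word l2 \<alpha> \<in> positive")
    case True
    then have "refl_word l2 \<alpha> = \<gamma>"
      using Cons.prems Cons.hyps by (auto simp: simple_def)
    then show ?thesis by (intro exI[of _ "[]"] exI[of _ l2]) auto
  next
    case False
    then obtain l1 l3 where "l2 = l1 @ refl_word l3 \<alpha> # l3"
      using Cons by auto
    then show ?thesis by (intro exI[of _ "\<gamma> # l1"] exI[of _ l3]) auto
  qed
qed simp

text \<open>This is the deletion property of Coxeter groups: a shortest word for a group element sends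
  the root of its last letter to a negative root, since otherwise that letter and the one found
  in \<open>sign_change_letter\<close> could both be deleted.\<close>

lemma reduced_simple_word:
  assumes "l \<in> lists simple"
  obtains m where "m \<in> lists simple" "refl_word m = refl_word l" "length m \<le> length l"
    "m = [] \<or> refl_word m (last m) \<notin> positive"
proof -
  define P where "P m \<longleftrightarrow> m \<in> lists simple \<and> refl_word m = refl_word l" for m
  have "P l" using assms by (simp add: P_def)
  then obtain m where m: "P m" and least: "\<And>k. P k \<Longrightarrow> length m \<le> length k"
    using ex_has_least_nat[of P l length] by blast
  have "refl_word m (last m) \<notin> positive" if nonempty: "m \<noteq> []"
  proof
    assume pos: "refl_word m (last m) \<in> positive"
    obtain k \<alpha> where k: "m = k @ [\<alpha>]" using nonempty by (cases m rule: rev_cases) auto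
    have \<alpha>: "\<alpha> \<in> simple" "\<alpha> \<in> positive" "\<alpha> \<in> \<Phi>" and kl: "k \<in> lists simple"
      using m simple_positive positive_root by (auto simp: P_def k)
    have "refl_word m \<alpha> = - refl_word k \<alpha>"
      using reflection_self[OF root_nonzero[OF \<alpha>(3)]] linear_neg[OF linear_refl_word[of k]]
      by (simp add: k refl_word_append)
    then have "refl_word k \<alpha> \<notin> positive"
      using not_positive_iff[of "refl_word k \<alpha>"] pos refl_word_root[OF simple_words[OF kl] \<alpha>(3)]
      by (simp add: k)
    then obtain l1 l2 where l12: "k = l1 @ refl_word l2 \<alpha> # l2"
      using sign_change_letter kl \<alpha> by blast
    have "refl_word m x = refl_word (l1 @ l2) x" for x
      using reflection_conjugate[OF orthogonal_refl_word[of l2], of \<alpha> "reflection \<alpha> x"]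
      by (simp add: k l12 refl_word_append reflection_reflection)
    then have "P (l1 @ l2)"
      using m kl by (auto simp: P_def l12 fun_eq_iff)
    from least[OF this] show False by (simp add: k l12)
  qed
  then have "m = [] \<or> refl_word m (last m) \<notin> positive" by blast
  moreover have "m \<in> lists simple" "refl_word m = refl_word l"
    using m by (simp_all add: P_def)
  ultimately show ?thesis
    using that[of m] least[OF \<open>P l\<close>] by blast
qed

text \<open>An element that fixes \<open>b\<close> permutes the positive roots, so its shortest word is empty.\<close>

lemma fixes_regular_imp_id:
  assumes "l \<in> lists \<Phi>" "refl_word l b = b"
  shows "refl_word l = (\<lambda>x. x)"
proof -
  obtain k where k: "k \<in> lists simple" "refl_word k = refl_word l"
    using word_as_simple_word assms by blast
  obtain m where m: "m \<in> lists simple" "refl_word m = refl_word k"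
    "m = [] \<or> refl_word m (last m) \<notin> positive"
    using reduced_simple_word[OF k(1)] by metis
  have "m = []"
  proof (rule ccontr)
    assume "m \<noteq> []"
    then have "last m \<in> positive"
      using m(1) simple_positive last_in_set unfolding lists_eq_set by blast
    moreover have "refl_word m (last m) \<bullet> b = last m \<bullet> b"
      using refl_word_inner[of m "last m" b] m k assms by simp
    ultimately have "refl_word m (last m) \<in> positive"
      using refl_word_root[OF simple_words[OF m(1)]] by (auto simp: positive_def)
    then show False using m \<open>m \<noteq> []\<close> by simp
  qed
  then show ?thesis using m k by simp
qed

text \<open>The closed chamber meets an orbit at most once: the last letter of a shortest word that maps a
  dominant vector to a dominant one must fix the first of them, so it can be dropped.\<close>

lemma dominant_unique_simple:
  assumes "l \<in> lists simple" "dominant x" "dominant (refl_word l x)"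
  shows "refl_word l x = x"
  using assms
proof (induction "length l" arbitrary: l rule: less_induct)
  case less
  obtain m where m: "m \<in> lists simple" "refl_word m = refl_word l" "length m \<le> length l"
    "m = [] \<or> refl_word m (last m) \<notin> positive"
    using reduced_simple_word[OF less.prems(1)] by metis
  show ?case
  proof (cases m rule: rev_cases)
    case Nil
    then show ?thesis using m by (metis refl_word.simps(1))
  next
    case (snoc k \<alpha>)
    have \<alpha>: "\<alpha> \<in> positive" "\<alpha> \<in> \<Phi>" and kl: "k \<in> lists simple"
      using m simple_positive positive_root by (auto simp: snoc)
    have "refl_word m \<alpha> \<in> \<Phi>"
      using refl_word_root[OF simple_words[OF m(1)]] \<alpha> by simp
    then have "- refl_word m \<alpha> \<in> positive"
      using m not_positive_iff by (auto simp: snoc)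
    then have "0 \<le> refl_word m x \<bullet> - refl_word m \<alpha>"
      using less.prems m by (auto simp: dominant_def)
    then have "x \<bullet> \<alpha> \<le> 0"
      using refl_word_inner[of m x \<alpha>] by simp
    then have "x \<bullet> \<alpha> = 0"
      using less.prems \<alpha> by (force simp: dominant_def)
    then have "reflection \<alpha> x = x" by (simp add: reflection_def)
    then have "refl_word l x = refl_word k x"
      using m by (metis refl_word_append refl_word.simps snoc)
    then show ?thesis
      using less.hyps[of k] less.prems m kl by (simp add: snoc)
  qed
qed

lemma dominant_unique:
  assumes "l \<in> lists \<Phi>" "dominant x" "dominant (refl_word l x)"
  shows "refl_word l x = x"
  using word_as_simple_word[OF assms(1)] dominant_unique_simple assms by metis

text \<open>Applying the reflection in a positive root \<open>\<alpha>\<close> ahead of the word moves the image of \<open>a\<close>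
  in the direction opposite to the image of \<open>\<alpha>\<close>, and this cannot increase the inner product
  with \<open>c\<close>.\<close>

lemma maximal_imp_dominant:
  assumes a: "\<And>\<alpha>. \<alpha> \<in> positive \<Longrightarrow> 0 < \<alpha> \<bullet> a"
    and l: "l \<in> lists \<Phi>"
    and max: "\<And>m. m \<in> lists \<Phi> \<Longrightarrow> c \<bullet> refl_word m a \<le> c \<bullet> refl_word l a"
  shows "dominant (refl_word (rev l) c)"
  unfolding dominant_def
proof
  fix \<alpha> assume \<alpha>: "\<alpha> \<in> positive"
  define k where "k = 2 * (a \<bullet> \<alpha>) / (\<alpha> \<bullet> \<alpha>)"
  have "0 < k"
    using a[OF \<alpha>] root_nonzero[OF positive_root[OF \<alpha>]] by (simp add: k_def inner_commute)
  have "c \<bullet> refl_word (l @ [\<alpha>]) a \<le> c \<bullet> refl_word l a"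
    using max[of "l @ [\<alpha>]"] l positive_root[OF \<alpha>] by simp
  also have "refl_word (l @ [\<alpha>]) a = refl_word l a - k *\<^sub>R refl_word l \<alpha>"
    using linear_refl_word[of l]
    by (simp add: refl_word_append reflection_def k_def linear_diff linear_cmul)
  finally have "0 \<le> k * (c \<bullet> refl_word l \<alpha>)"
    by (simp add: inner_diff_right)
  then have "0 \<le> c \<bullet> refl_word l \<alpha>"
    using \<open>0 < k\<close> by (simp add: zero_le_mult_iff)
  then show "0 \<le> refl_word (rev l) c \<bullet> \<alpha>"
    by (simp add: refl_word_inner_rev)
qed

text \<open>If \<open>w\<close> maximises \<open>c\<close> over the orbit of \<open>b\<close>, then the inverse of \<open>w\<close> moves \<open>c\<close> to the
  only dominant vector of its orbit. For an \<open>a\<close> in the chamber of \<open>b\<close>, a maximiser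
  over the orbit of \<open>a\<close> moves \<open>c\<close> to the same vector, and the maximum is the inner product of
  that vector with \<open>a\<close>.\<close>

lemma maximal_transfer:
  assumes fin: "finite (refl_word ` lists \<Phi>)"
    and a: "\<And>\<alpha>. \<alpha> \<in> positive \<Longrightarrow> 0 < \<alpha> \<bullet> a"
    and l: "l \<in> lists \<Phi>"
    and max: "\<And>m. m \<in> lists \<Phi> \<Longrightarrow> c \<bullet> refl_word m b \<le> c \<bullet> refl_word l b"
    and m: "m \<in> lists \<Phi>"
  shows "c \<bullet> refl_word m a \<le> c \<bullet> refl_word l a"
proof -
  let ?A = "(\<lambda>w. c \<bullet> w a) ` refl_word ` lists \<Phi>"
  have "finite ?A" "?A \<noteq> {}" using fin by auto
  then have "Max ?A \<in> ?A" by (rule Max_in)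
  then obtain k where k: "k \<in> lists \<Phi>" "Max ?A = c \<bullet> refl_word k a"
    unfolding image_iff by blast
  have kmax: "c \<bullet> refl_word m a \<le> c \<bullet> refl_word k a" if "m \<in> lists \<Phi>" for m
    using Max_ge[OF \<open>finite ?A\<close>, of "c \<bullet> refl_word m a"] that k by auto
  let ?x = "refl_word (rev l) c" and ?y = "refl_word (rev k) c"
  have x: "dominant ?x"
    by (rule maximal_imp_dominant[OF _ l max]) (auto simp: positive_def)
  have y: "?y = refl_word (rev k @ l) ?x"
    using refl_word_rev[of "rev l" c] by (simp add: refl_word_append)
  have "dominant ?y"
    by (rule maximal_imp_dominant[OF a k(1) kmax])
  then have dom: "dominant (refl_word (rev k @ l) ?x)"
    by (simp only: y[symmetric])
  have "rev k @ l \<in> lists \<Phi>" using k l by auto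
  from trans[OF y dominant_unique[OF this x dom]] have "?y = ?x" .
  then have "c \<bullet> refl_word k a = c \<bullet> refl_word l a"
    by (simp add: refl_word_inner_rev)
  then show ?thesis using kmax[OF m] by simp
qed

end

section \<open>The action of the group on a chamber\<close>

lemma chamber_inner_sign:
  assumes B: "open_chamber \<Phi> B" and "a \<in> B" "b \<in> B" "\<alpha> \<in> \<Phi>" "0 < \<alpha> \<bullet> b"
  shows "0 < \<alpha> \<bullet> a"
proof (rule ccontr)
  assume "\<not> ?thesis"
  have "connected B" and B0: "B \<subseteq> - (\<Union>\<alpha>\<in>\<Phi>. {x. \<alpha> \<bullet> x = 0})"
    using B in_components_connected in_components_subset unfolding open_chamber_def by blast+
  then have "connected ((\<lambda>x. \<alpha> \<bullet> x) ` B)"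
    by (intro connected_continuous_image continuous_intros)
  then have "0 \<in> (\<lambda>x. \<alpha> \<bullet> x) ` B"
    using connectedD_interval[of _ "\<alpha> \<bullet> a" "\<alpha> \<bullet> b" 0] assms \<open>\<not> 0 < \<alpha> \<bullet> a\<close> by auto
  then show False using B0 \<open>\<alpha> \<in> \<Phi>\<close> by auto
qed

lemma chamber_regular_vector:
  assumes "root_system \<Phi>" "open_chamber \<Phi> B" "b \<in> B"
  shows "regular_vector \<Phi> b"
  using assms in_components_subset unfolding open_chamber_def regular_vector_def by blast

lemma chamber_action_free:
  assumes W: "finite_reflection_group W \<Phi>" and B: "open_chamber \<Phi> B" "b \<in> B"
    and w: "v \<in> W" "w \<in> W" "v b = w b"
  shows "v = w"
proof -
  interpret regular_vector \<Phi> b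
    using chamber_regular_vector W B unfolding finite_reflection_group_def by blast
  obtain k l where kl: "k \<in> lists \<Phi>" "l \<in> lists \<Phi>" "v = refl_word k" "w = refl_word l"
    using W w unfolding finite_reflection_group_def generate_reflections by auto
  have "refl_word (rev l @ k) b = b"
    using w kl by (simp add: refl_word_append refl_word_rev)
  then have id: "refl_word (rev l @ k) = (\<lambda>x. x)"
    using kl by (intro fixes_regular_imp_id) auto
  have "v x = w x" for x
    using refl_word_rev[of "rev l" "refl_word k x"] fun_cong[OF id, of x] kl
    by (simp add: refl_word_append)
  then show ?thesis by auto
qed

lemma chamber_maximal_transfer:
  assumes W: "finite_reflection_group W \<Phi>" and B: "open_chamber \<Phi> B" "a \<in> B" "b \<in> B"
    and w: "w \<in> W" and max: "\<forall>v\<in>W. c \<bullet> v b \<le> c \<bullet> w b"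
  shows "\<forall>v\<in>W. c \<bullet> v a \<le> c \<bullet> w a"
proof -
  interpret regular_vector \<Phi> b
    using chamber_regular_vector W B unfolding finite_reflection_group_def by blast
  have Weq: "W = refl_word ` lists \<Phi>" and fin: "finite (refl_word ` lists \<Phi>)"
    using W unfolding finite_reflection_group_def generate_reflections by auto
  have "0 < \<alpha> \<bullet> a" if "\<alpha> \<in> positive" for \<alpha>
    using that chamber_inner_sign[OF B(1), of a b \<alpha>] B by (auto simp: positive_def)
  then have pos: "\<And>\<alpha>. \<alpha> \<in> positive \<Longrightarrow> 0 < \<alpha> \<bullet> a" .
  obtain l where l: "l \<in> lists \<Phi>" "w = refl_word l"
    using w unfolding Weq by auto
  have "c \<bullet> refl_word m b \<le> c \<bullet> refl_word l b" if "m \<in> lists \<Phi>" for m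
    using max that l unfolding Weq by auto
  from maximal_transfer[OF fin pos l(1) this] show ?thesis
    unfolding Weq using l by auto
qed

lemma group_element_orthogonal:
  assumes "finite_reflection_group W \<Phi>" "w \<in> W"
  shows "orthogonal_transformation w"
  using assms orthogonal_refl_word
  unfolding finite_reflection_group_def generate_reflections by auto

lemma id_in_group:
  assumes "finite_reflection_group W \<Phi>"
  shows "(\<lambda>x. x) \<in> W"
proof -
  have "refl_word [] \<in> W"
    using assms unfolding finite_reflection_group_def generate_reflections by blast
  then show ?thesis by simp
qed

section \<open>Two injectivity and surjectivity criteria\<close>

text \<open>Invariance of domain makes the image of the relative interior of \<open>P\<close> relatively open, so it
  lies in the relative interior of \<open>Q\<close>; as boundary points only reach the boundary, it is also
  relatively closed there, and the relative interior of \<open>Q\<close> is connected.\<close>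

lemma boundary_preserving_injection_onto:
  fixes f :: "'a::euclidean_space \<Rightarrow> 'b::euclidean_space"
  assumes P: "compact P" "convex P" "P \<noteq> {}" and Q: "closed Q" "convex Q"
    and dim: "aff_dim Q \<le> aff_dim P"
    and f: "continuous_on P f" "inj_on f P" "f ` P \<subseteq> Q"
    and bd: "\<And>x. x \<in> P \<Longrightarrow> x \<notin> rel_interior P \<Longrightarrow> f x \<notin> rel_interior Q"
  shows "f ` P = Q"
proof -
  let ?R = "f ` rel_interior P"
  have sub: "rel_interior P \<subseteq> P" by (rule rel_interior_subset)
  have "openin (top_of_set (affine hull Q)) ?R"
  proof (rule invariance_of_domain_affine_sets)
    show "openin (top_of_set (affine hull P)) (rel_interior P)"
      by (rule openin_rel_interior)
    show "continuous_on (rel_interior P) f" "inj_on f (rel_interior P)"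
      using f sub continuous_on_subset inj_on_subset by blast+
    show "f \<in> rel_interior P \<rightarrow> affine hull Q"
      using f sub hull_subset[of Q affine] by auto
  qed (use dim in auto)
  then have opn: "openin (top_of_set (affine hull Q)) ?R" .
  moreover have "?R \<subseteq> Q" using f sub by auto
  ultimately have RQ: "?R \<subseteq> rel_interior Q"
    by (intro rel_interior_maximal)
  have "rel_interior Q \<subseteq> affine hull Q"
    using rel_interior_subset[of Q] hull_subset[of Q affine] by auto
  then have "openin (top_of_set (rel_interior Q)) ?R"
    using openin_subset_trans[OF opn RQ] by simp
  moreover have "?R = rel_interior Q \<inter> f ` P"
    using RQ bd sub by auto
  moreover have "compact (f ` P)"
    using f P compact_continuous_image by blast
  then have "closedin (top_of_set (rel_interior Q)) (rel_interior Q \<inter> f ` P)"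
    by (intro closedin_closed_Int compact_imp_closed)
  moreover have "connected (rel_interior Q)"
    using Q convex_rel_interior convex_connected by blast
  moreover have "?R \<noteq> {}"
    using P rel_interior_eq_empty by blast
  ultimately have "?R = rel_interior Q"
    unfolding connected_clopen by metis
  then have "rel_interior Q \<subseteq> f ` P" using sub by auto
  then have "closure (rel_interior Q) \<subseteq> f ` P"
    using \<open>compact (f ` P)\<close> by (intro closure_minimal compact_imp_closed)
  then show ?thesis
    using f convex_closure_rel_interior[OF Q(2)] closure_closed[OF Q(1)] by auto
qed

text \<open>If \<open>f\<close> identifies two points, their images under an approximating embedding \<open>g\<close> with convex
  image are joined by a short segment, whose preimage is a connected set on which \<open>f\<close> is nearly
  constant. This set meets every small sphere around the first point. Since the fibre is finite,
  some such sphere misses it, and by compactness \<open>f\<close> stays away from the common value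
  there.\<close>

lemma limit_of_convex_embeddings_inj:
  fixes f :: "'a::metric_space \<Rightarrow> 'b::euclidean_space"
  assumes P: "compact P" and f: "continuous_on P f"
    and fibres: "\<And>x. finite {y \<in> P. f y = x}"
    and approx: "\<And>e. 0 < e \<Longrightarrow> \<exists>g. continuous_on P g \<and> inj_on g P \<and> convex (g ` P) \<and>
      (\<forall>y\<in>P. dist (g y) (f y) < e)"
  shows "inj_on f P"
proof (rule inj_onI, rule ccontr)
  fix y z assume yz: "y \<in> P" "z \<in> P" "f y = f z" "y \<noteq> z"
  let ?F = "dist y ` {u \<in> P. f u = f y}"
  have "infinite {0<..<dist y z}"
    using yz by (simp add: infinite_Ioo)
  then obtain r where r: "0 < r" "r < dist y z" "r \<notin> ?F"
    using fibres[of "f y"] by (metis (no_types, lifting) finite_imageI finite_subset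
        greaterThanLessThan_iff subsetI)
  define K where "K = {u \<in> P. dist y u = r}"
  have "closed {u. dist y u = r}"
    by (intro closed_Collect_eq continuous_intros)
  then have "compact (P \<inter> {u. dist y u = r})"
    using P compact_Int_closed by blast
  then have K: "compact K"
    by (simp add: K_def Collect_conj_eq)
  have "closed (f ` K)"
    using compact_continuous_image[OF continuous_on_subset[OF f] K]
    by (auto simp: K_def compact_imp_closed)
  moreover have "f y \<notin> f ` K"
    using r by (auto simp: K_def)
  ultimately obtain e where e: "0 < e" "\<And>u. u \<in> K \<Longrightarrow> e \<le> dist (f y) (f u)"
    using separate_point_closed[of "f ` K" "f y"] by blast
  obtain g where g: "continuous_on P g" "inj_on g P" "convex (g ` P)"
    and gf: "\<And>u. u \<in> P \<Longrightarrow> dist (g u) (f u) < e / 2"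
    using approx[of "e / 2"] e by auto
  define h where "h = inv_into P g"
  have hg: "\<forall>u\<in>P. h (g u) = u"
    using g by (simp add: h_def)
  have segP: "closed_segment (g y) (g z) \<subseteq> g ` P"
    using g yz by (intro closed_segment_subset) auto
  have "continuous_on (closed_segment (g y) (g z)) h"
    using continuous_on_inv[OF g(1) P hg] segP continuous_on_subset by blast
  then have "continuous_on (closed_segment (g y) (g z)) (\<lambda>x. dist y (h x))"
    by (intro continuous_intros)
  then have "connected ((\<lambda>x. dist y (h x)) ` closed_segment (g y) (g z))"
    by (intro connected_continuous_image connected_segment)
  moreover have "0 \<in> (\<lambda>x. dist y (h x)) ` closed_segment (g y) (g z)"
    using yz hg by (intro image_eqI[of _ _ "g y"]) auto
  moreover have "dist y z \<in> (\<lambda>x. dist y (h x)) ` closed_segment (g y) (g z)"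
    using yz hg by (intro image_eqI[of _ _ "g z"]) auto
  ultimately have "r \<in> (\<lambda>x. dist y (h x)) ` closed_segment (g y) (g z)"
    using r connectedD_interval[of _ 0 "dist y z" r] by auto
  then obtain x where x: "x \<in> closed_segment (g y) (g z)" "dist y (h x) = r" by auto
  then obtain u where u: "u \<in> P" "x = g u" using segP by auto
  then have uK: "u \<in> K" using x hg by (simp add: K_def)
  have "g y \<in> ball (f y) (e / 2)" "g z \<in> ball (f y) (e / 2)"
    using gf[of y] gf[of z] yz by (auto simp: dist_commute)
  then have "closed_segment (g y) (g z) \<subseteq> ball (f y) (e / 2)"
    by (intro closed_segment_subset) auto
  then have "dist (f y) (g u) < e / 2" using x u by auto
  then have "dist (f y) (f u) < e"
    using gf[OF u(1)] dist_triangle[of "f y" "f u" "g u"] by simp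
  then show False using e(2)[OF uK] by simp
qed

section \<open>Convex weights and labelled points\<close>

definition weights :: "'w set \<Rightarrow> ('w \<Rightarrow> real) set" where
  "weights A = {\<mu>. (\<forall>w. 0 \<le> \<mu> w) \<and> (\<forall>w. w \<notin> A \<longrightarrow> \<mu> w = 0) \<and> sum \<mu> A = 1}"

definition bary :: "'w set \<Rightarrow> ('w \<Rightarrow> 'v::real_vector) \<Rightarrow> ('w \<Rightarrow> real) \<Rightarrow> 'v" where
  "bary A v \<mu> = (\<Sum>w\<in>A. \<mu> w *\<^sub>R v w)"

lemma weights_mono:
  assumes "finite A'" "A \<subseteq> A'" "\<mu> \<in> weights A"
  shows "\<mu> \<in> weights A'"
proof -
  have "sum \<mu> A = sum \<mu> A'"
    using assms by (intro sum.mono_neutral_left) (auto simp: weights_def)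
  then show ?thesis using assms by (auto simp: weights_def)
qed

lemma weights_Int:
  assumes "finite A" "\<mu> \<in> weights A" "\<mu> \<in> weights A'"
  shows "\<mu> \<in> weights (A \<inter> A')"
proof -
  have "sum \<mu> (A \<inter> A') = sum \<mu> A"
    using assms by (intro sum.mono_neutral_left) (auto simp: weights_def)
  then show ?thesis using assms by (auto simp: weights_def)
qed

lemma bary_extend:
  assumes "finite A'" "A \<subseteq> A'" "\<mu> \<in> weights A"
  shows "bary A' v \<mu> = bary A v \<mu>"
  unfolding bary_def using assms by (intro sum.mono_neutral_right) (auto simp: weights_def)

lemma weights_le_1:
  assumes "finite A" "\<mu> \<in> weights A"
  shows "\<mu> w \<le> 1"
proof (cases "w \<in> A")
  case True
  then show ?thesis
    using assms member_le_sum[of w A \<mu>] by (auto simp: weights_def)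
qed (use assms in \<open>auto simp: weights_def\<close>)

lemma bary_weights:
  assumes "finite A"
  shows "bary A v ` weights A = convex hull (v ` A)"
proof
  show "bary A v ` weights A \<subseteq> convex hull (v ` A)"
  proof clarify
    fix \<mu> assume "\<mu> \<in> weights A"
    then show "bary A v \<mu> \<in> convex hull (v ` A)"
      unfolding bary_def using assms
      by (intro convex_sum) (auto simp: weights_def intro: hull_inc)
  qed
  have "convex (bary A v ` weights A)"
  proof (rule convexI, clarify)
    fix s t :: real and \<mu> \<nu>
    assume *: "0 \<le> s" "0 \<le> t" "s + t = 1" "\<mu> \<in> weights A" "\<nu> \<in> weights A"
    have mem: "(\<lambda>w. s * \<mu> w + t * \<nu> w) \<in> weights A"
      using * by (auto simp: weights_def sum.distrib simp flip: sum_distrib_left)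
    have eq: "bary A v (\<lambda>w. s * \<mu> w + t * \<nu> w) = s *\<^sub>R bary A v \<mu> + t *\<^sub>R bary A v \<nu>"
      by (simp add: bary_def scaleR_add_left sum.distrib scaleR_sum_right)
    show "s *\<^sub>R bary A v \<mu> + t *\<^sub>R bary A v \<nu> \<in> bary A v ` weights A"
      unfolding eq[symmetric] using mem by (rule imageI)
  qed
  moreover have "v ` A \<subseteq> bary A v ` weights A"
  proof clarify
    fix w assume "w \<in> A"
    let ?\<delta> = "\<lambda>u. if u = w then 1 else (0::real)"
    have eq: "bary A v ?\<delta> = v w"
      using assms \<open>w \<in> A\<close>
      by (simp add: bary_def if_distrib[of "\<lambda>t. t *\<^sub>R _"] sum.delta cong: if_cong)
    have mem: "?\<delta> \<in> weights A"
      using assms \<open>w \<in> A\<close> by (auto simp: weights_def)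
    show "v w \<in> bary A v ` weights A"
      unfolding eq[symmetric] using mem by (rule imageI)
  qed
  ultimately show "convex hull (v ` A) \<subseteq> bary A v ` weights A"
    by (rule hull_minimal[rotated])
qed

text \<open>On a simplex, a barycentric coordinate extends to an affine function of the ambient
  space.\<close>

lemma simplex_coordinate_lipschitz:
  fixes v :: "'w \<Rightarrow> 'v::euclidean_space"
  assumes A: "finite A" "inj_on v A" "\<not> affine_dependent (v ` A)" and w: "w \<in> A"
  shows "\<exists>M\<ge>0. \<forall>\<mu>\<in>weights A. \<forall>\<nu>\<in>weights A.
    \<bar>\<mu> w - \<nu> w\<bar> \<le> M * norm (bary A v \<mu> - bary A v \<nu>)"
proof (cases "A = {w}")
  case True
  then show ?thesis by (intro exI[of _ 0]) (auto simp: weights_def)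
next
  case False
  \<comment> \<open>Any other vertex serves as the origin.\<close>
  then obtain p where p: "p \<in> A" "p \<noteq> w" using w by auto
  let ?B = "(\<lambda>x. - v p + x) ` (v ` A - {v p})"
  have "independent ?B"
    using A p affine_dependent_iff_dependent2[of "v p" "v ` A"] by auto
  then obtain g :: "'v \<Rightarrow> real" where g: "linear g"
    and gB: "\<And>x. x \<in> ?B \<Longrightarrow> g x = (if x = - v p + v w then 1 else 0)"
    using linear_independent_extend[of ?B "\<lambda>x. if x = - v p + v w then 1 else 0"] by blast
  have gv: "g (v u - v p) = (if u = w then 1 else 0)" if "u \<in> A" for u
  proof (cases "u = p")
    case True
    then show ?thesis using p linear_0[OF g] by simp
  next
    case False
    then have "- v p + v u \<in> ?B"
      using that p A by (auto simp: inj_on_def)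
    from gB[OF this] show ?thesis
      using that w A by (auto simp: inj_on_def)
  qed
  obtain M where M: "0 < M" "\<And>x. norm (g x) \<le> M * norm x"
    using linear_bounded_pos[OF g] by blast
  have "\<bar>\<mu> w - \<nu> w\<bar> \<le> M * norm (bary A v \<mu> - bary A v \<nu>)"
    if "\<mu> \<in> weights A" "\<nu> \<in> weights A" for \<mu> \<nu>
  proof -
    have zero: "(\<Sum>u\<in>A. \<mu> u - \<nu> u) = 0"
      using that by (simp add: weights_def sum_subtractf)
    have "bary A v \<mu> - bary A v \<nu> = (\<Sum>u\<in>A. (\<mu> u - \<nu> u) *\<^sub>R v u) - (\<Sum>u\<in>A. \<mu> u - \<nu> u) *\<^sub>R v p"
      unfolding zero by (simp add: bary_def scaleR_diff_left sum_subtractf)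
    also have "\<dots> = (\<Sum>u\<in>A. (\<mu> u - \<nu> u) *\<^sub>R (v u - v p))"
      by (simp only: scaleR_diff_right scaleR_sum_left flip: sum_subtractf)
    finally have "g (bary A v \<mu> - bary A v \<nu>) = (\<Sum>u\<in>A. (\<mu> u - \<nu> u) * g (v u - v p))"
      using g by (simp add: linear_sum linear_cmul)
    also have "\<dots> = (\<Sum>u\<in>A. if u = w then \<mu> u - \<nu> u else 0)"
      by (intro sum.cong) (auto simp: gv)
    also have "\<dots> = \<mu> w - \<nu> w"
      using A w by simp
    finally show ?thesis
      using M(2)[of "bary A v \<mu> - bary A v \<nu>"] by simp
  qed
  then show ?thesis using M by (intro exI[of _ M]) auto
qed

lemma simplex_weights_unique:
  fixes v :: "'w \<Rightarrow> 'v::euclidean_space"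
  assumes A: "finite A" "inj_on v A" "\<not> affine_dependent (v ` A)"
    and eq: "\<mu> \<in> weights A" "\<nu> \<in> weights A" "bary A v \<mu> = bary A v \<nu>"
  shows "\<mu> = \<nu>"
proof
  fix w
  show "\<mu> w = \<nu> w"
  proof (cases "w \<in> A")
    case True
    then obtain M where "\<bar>\<mu> w - \<nu> w\<bar> \<le> M * norm (bary A v \<mu> - bary A v \<nu>)"
      using simplex_coordinate_lipschitz[OF A] eq by blast
    then show ?thesis using eq by simp
  qed (use eq in \<open>auto simp: weights_def\<close>)
qed

section \<open>Labelled triangulations and their deformations\<close>

locale label_complex =
  fixes W :: "'w set" and I :: "'i set" and S :: "'i \<Rightarrow> 'w set"
  assumes finite_W: "finite W" and finite_I: "finite I"
    and S_subset: "\<And>i. i \<in> I \<Longrightarrow> S i \<subseteq> W"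
begin

text \<open>The geometric realisation of the abstract complex whose maximal simplices are the label
  sets \<open>S i\<close>.\<close>

definition realisation :: "('w \<Rightarrow> real) set" where
  "realisation = (\<Union>i\<in>I. weights (S i))"

definition nondegenerate :: "('w \<Rightarrow> 'v::euclidean_space) \<Rightarrow> bool" where
  "nondegenerate v \<longleftrightarrow> (\<forall>i\<in>I. inj_on v (S i) \<and> \<not> affine_dependent (v ` S i))"

text \<open>Injectivity on the realisation says that the simplices meet in common faces, surjectivity
  that they cover the polytope.\<close>

definition triangulates :: "('w \<Rightarrow> 'v::euclidean_space) \<Rightarrow> bool" where
  "triangulates v \<longleftrightarrow> nondegenerate v \<and> bij_betw (bary W v) realisation (convex hull (v ` W))"

definition coord :: "('w \<Rightarrow> 'v::euclidean_space) \<Rightarrow> 'v \<Rightarrow> 'w \<Rightarrow> real" where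
  "coord v = inv_into realisation (bary W v)"

text \<open>The piecewise affine map that carries the triangulation with vertices \<open>v\<close> to the simplices
  with vertices \<open>u\<close>.\<close>

definition transition :: "('w \<Rightarrow> 'v::euclidean_space) \<Rightarrow> ('w \<Rightarrow> 'v) \<Rightarrow> 'v \<Rightarrow> 'v" where
  "transition v u y = bary W u (coord v y)"

definition displacement :: "('w \<Rightarrow> 'v::euclidean_space) \<Rightarrow> ('w \<Rightarrow> 'v) \<Rightarrow> real" where
  "displacement u v = (\<Sum>w\<in>W. norm (u w - v w))"

lemma finite_S: "i \<in> I \<Longrightarrow> finite (S i)"
  using S_subset finite_W finite_subset by blast

lemma realisation_weights: "\<mu> \<in> realisation \<Longrightarrow> \<mu> \<in> weights W"
  unfolding realisation_def using weights_mono[OF finite_W S_subset] by blast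

lemma bary_S: "i \<in> I \<Longrightarrow> \<mu> \<in> weights (S i) \<Longrightarrow> bary W v \<mu> = bary (S i) v \<mu>"
  using bary_extend[OF finite_W S_subset] by blast

lemma bary_S_image: "i \<in> I \<Longrightarrow> bary W v ` weights (S i) = convex hull (v ` S i)"
  using bary_weights[OF finite_S, of i v] bary_S by (metis image_cong)

lemma nondegenerate_inj:
  assumes "nondegenerate v" "i \<in> I"
  shows "inj_on (bary W v) (weights (S i))"
proof (rule inj_onI)
  fix \<mu> \<nu> assume "\<mu> \<in> weights (S i)" "\<nu> \<in> weights (S i)" "bary W v \<mu> = bary W v \<nu>"
  then show "\<mu> = \<nu>"
    using assms bary_S[OF assms(2), of _ v] unfolding nondegenerate_def
    by (intro simplex_weights_unique[OF finite_S[OF assms(2)], of v]) auto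
qed

lemma bary_in_hull: "\<mu> \<in> weights W \<Longrightarrow> bary W v \<mu> \<in> convex hull (v ` W)"
  using bary_weights[OF finite_W, of v] by blast

lemma hull_as_bary: "x \<in> convex hull (v ` W) \<Longrightarrow> \<exists>\<mu>\<in>weights W. x = bary W v \<mu>"
  using bary_weights[OF finite_W, of v] by auto

lemma displacement_nonneg: "0 \<le> displacement u v"
  by (simp add: displacement_def sum_nonneg)

lemma bary_displacement:
  assumes "\<mu> \<in> weights W"
  shows "norm (bary W u \<mu> - bary W v \<mu>) \<le> displacement u v"
proof -
  have "bary W u \<mu> - bary W v \<mu> = (\<Sum>w\<in>W. \<mu> w *\<^sub>R (u w - v w))"
    by (simp add: bary_def scaleR_diff_right sum_subtractf)
  also have "norm \<dots> \<le> (\<Sum>w\<in>W. norm (u w - v w))"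
  proof (intro sum_norm_le)
    fix w
    have "0 \<le> \<mu> w" "\<mu> w \<le> 1"
      using assms weights_le_1[OF finite_W] by (auto simp: weights_def)
    then show "norm (\<mu> w *\<^sub>R (u w - v w)) \<le> norm (u w - v w)"
      by (simp add: mult_left_le_one_le)
  qed
  finally show ?thesis by (simp add: displacement_def)
qed

lemma coord_bary:
  "triangulates v \<Longrightarrow> \<mu> \<in> realisation \<Longrightarrow> coord v (bary W v \<mu>) = \<mu>"
  unfolding triangulates_def coord_def bij_betw_def by simp

lemma coord_realisation:
  "triangulates v \<Longrightarrow> y \<in> convex hull (v ` W) \<Longrightarrow> coord v y \<in> realisation"
  unfolding triangulates_def coord_def bij_betw_def by (metis inv_into_into)

lemma bary_coord:
  "triangulates v \<Longrightarrow> y \<in> convex hull (v ` W) \<Longrightarrow> bary W v (coord v y) = y"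
  unfolding triangulates_def coord_def bij_betw_def by (metis f_inv_into_f)

lemma transition_bary:
  "triangulates v \<Longrightarrow> \<mu> \<in> realisation \<Longrightarrow> transition v u (bary W v \<mu>) = bary W u \<mu>"
  by (simp add: transition_def coord_bary)

lemma compact_hull: "compact (convex hull (v ` W :: 'v::euclidean_space set))"
  using finite_W by (simp add: finite_imp_compact_convex_hull)

text \<open>The coordinates are uniformly Lipschitz on each of finitely many simplices; a segment in the
  polytope is cut by the simplices into finitely many closed pieces.\<close>

lemma coord_lipschitz:
  fixes v :: "'w \<Rightarrow> 'v::euclidean_space"
  assumes v: "triangulates v"
  shows "\<exists>M\<ge>0. \<forall>w\<in>W. \<forall>y\<in>convex hull (v ` W). \<forall>z\<in>convex hull (v ` W).
    \<bar>coord v y w - coord v z w\<bar> \<le> M * norm (y - z)"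
proof -
  have "\<exists>M\<ge>0. \<forall>\<mu>\<in>weights (S i). \<forall>\<nu>\<in>weights (S i).
      \<bar>\<mu> w - \<nu> w\<bar> \<le> M * norm (bary W v \<mu> - bary W v \<nu>)" if i: "i \<in> I" for i w
  proof (cases "w \<in> S i")
    case True
    then obtain M where "0 \<le> M" "\<forall>\<mu>\<in>weights (S i). \<forall>\<nu>\<in>weights (S i).
        \<bar>\<mu> w - \<nu> w\<bar> \<le> M * norm (bary (S i) v \<mu> - bary (S i) v \<nu>)"
      using simplex_coordinate_lipschitz[OF finite_S[OF i], of v w] v i
      unfolding triangulates_def nondegenerate_def by blast
    then show ?thesis by (intro exI[of _ M]) (simp add: bary_S[OF i])
  next
    case False
    then show ?thesis by (intro exI[of _ 0]) (auto simp: weights_def)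
  qed
  then obtain m where m0: "\<And>i w. i \<in> I \<Longrightarrow> 0 \<le> m i w"
    and m: "\<And>i w \<mu> \<nu>. \<lbrakk>i \<in> I; \<mu> \<in> weights (S i); \<nu> \<in> weights (S i)\<rbrakk> \<Longrightarrow>
      \<bar>\<mu> w - \<nu> w\<bar> \<le> m i w * norm (bary W v \<mu> - bary W v \<nu>)"
    by metis
  define M where "M = (\<Sum>i\<in>I. \<Sum>w\<in>W. m i w)"
  have M0: "0 \<le> M" unfolding M_def by (intro sum_nonneg m0)
  have mM: "m i w \<le> M" if "i \<in> I" "w \<in> W" for i w
  proof -
    have "m i w \<le> (\<Sum>w\<in>W. m i w)"
      using that m0 finite_W by (intro member_le_sum) auto
    also have "\<dots> \<le> M"
      unfolding M_def using that m0 finite_I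
      by (intro member_le_sum[of i I "\<lambda>i. \<Sum>w\<in>W. m i w"]) (auto intro: sum_nonneg)
    finally show ?thesis .
  qed
  have "\<bar>coord v y w - coord v z w\<bar> \<le> M * norm (y - z)"
    if w: "w \<in> W" and y: "y \<in> convex hull (v ` W)" and z: "z \<in> convex hull (v ` W)" for w y z
  proof -
    define \<gamma> where "\<gamma> t = (1 - t) *\<^sub>R y + t *\<^sub>R z" for t
    define U where "U i = {0..1} \<inter> \<gamma> -` (convex hull (v ` S i))" for i
    have \<gamma>: "\<gamma> t \<in> convex hull (v ` W)" if "t \<in> {0..1}" for t
      using that y z by (auto simp: \<gamma>_def intro!: convexD_alt)
    have diff: "\<gamma> s - \<gamma> t = (t - s) *\<^sub>R (y - z)" for s t
      by (simp add: \<gamma>_def algebra_simps)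
    have "(M * norm (y - z))-lipschitz_on {0..1} (\<lambda>t. coord v (\<gamma> t) w)"
    proof (rule lipschitz_on_closed_Union[OF _ _ finite_I])
      fix i assume i: "i \<in> I"
      show "(M * norm (y - z))-lipschitz_on (U i) (\<lambda>t. coord v (\<gamma> t) w)"
      proof (rule lipschitz_onI)
        fix s t assume "s \<in> U i" "t \<in> U i"
        then obtain \<mu> \<nu> where \<mu>: "\<mu> \<in> weights (S i)" "\<gamma> s = bary W v \<mu>"
          and \<nu>: "\<nu> \<in> weights (S i)" "\<gamma> t = bary W v \<nu>"
          unfolding U_def using bary_S_image[OF i, of v] by blast
        then have "coord v (\<gamma> s) = \<mu>" "coord v (\<gamma> t) = \<nu>"
          using coord_bary[OF v] i by (auto simp: realisation_def)
        then have "\<bar>coord v (\<gamma> s) w - coord v (\<gamma> t) w\<bar> \<le> m i w * norm (\<gamma> s - \<gamma> t)"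
          using m[OF i \<mu>(1) \<nu>(1)] \<mu> \<nu> by simp
        also have "\<dots> \<le> M * norm (\<gamma> s - \<gamma> t)"
          using mM[OF i w] by (intro mult_right_mono) auto
        finally show "dist (coord v (\<gamma> s) w) (coord v (\<gamma> t) w) \<le> M * norm (y - z) * dist s t"
          by (simp add: diff dist_real_def abs_minus_commute mult_ac)
      qed (simp add: M0)
      have "closed (convex hull (v ` S i))"
        using finite_S[OF i] by (simp add: finite_imp_compact_convex_hull compact_imp_closed)
      moreover have "continuous_on {0..1} \<gamma>"
        unfolding \<gamma>_def by (intro continuous_intros)
      ultimately show "closed (U i)"
        unfolding U_def by (intro continuous_closed_preimage) auto
    next
      show "{0..1} \<subseteq> (\<Union>i\<in>I. U i)"
      proof
        fix t :: real assume t: "t \<in> {0..1}"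
        obtain i where i: "i \<in> I" "coord v (\<gamma> t) \<in> weights (S i)"
          using coord_realisation[OF v \<gamma>[OF t]] by (auto simp: realisation_def)
        then have "\<gamma> t \<in> convex hull (v ` S i)"
          using imageI[OF i(2), of "bary W v"] bary_S_image[OF i(1), of v] bary_coord[OF v \<gamma>[OF t]]
          by simp
        then show "t \<in> (\<Union>i\<in>I. U i)" using i t by (auto simp: U_def)
      qed
    qed (simp add: M0)
    from lipschitz_onD[OF this, of 0 1] show ?thesis
      by (simp add: \<gamma>_def dist_real_def)
  qed
  then show ?thesis using M0 by blast
qed

lemma continuous_transition:
  fixes v u :: "'w \<Rightarrow> 'v::euclidean_space"
  assumes v: "triangulates v"
  shows "continuous_on (convex hull (v ` W)) (transition v u)"
proof -
  obtain M where M: "0 \<le> M" "\<And>w y z. \<lbrakk>w \<in> W; y \<in> convex hull (v ` W); z \<in> convex hull (v ` W)\<rbrakk>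
    \<Longrightarrow> \<bar>coord v y w - coord v z w\<bar> \<le> M * norm (y - z)"
    using coord_lipschitz[OF v] by blast
  have "continuous_on (convex hull (v ` W)) (\<lambda>y. coord v y w)" if "w \<in> W" for w
  proof (rule lipschitz_on_continuous_on)
    show "M-lipschitz_on (convex hull (v ` W)) (\<lambda>y. coord v y w)"
      using M that by (intro lipschitz_onI) (auto simp: dist_real_def dist_norm)
  qed
  then show ?thesis
    unfolding transition_def[abs_def] bary_def by (intro continuous_intros)
qed

lemma transition_in_hull:
  assumes "triangulates v" "y \<in> convex hull (v ` W)"
  shows "transition v u y \<in> convex hull (u ` W)"
  unfolding transition_def
  using bary_in_hull realisation_weights coord_realisation[OF assms] by blast

text \<open>The difference of the transition map and the identity has a Lipschitz constant proportional
  to the displacement of the vertices, because it is a combination of the displacements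
  whose coefficients are the coordinates.\<close>

lemma transition_injective:
  fixes v :: "'w \<Rightarrow> 'v::euclidean_space"
  assumes v: "triangulates v"
  shows "\<exists>e>0. \<forall>u. displacement u v < e \<longrightarrow> inj_on (transition v u) (convex hull (v ` W))"
proof -
  obtain M where M: "0 \<le> M" "\<And>w y z. \<lbrakk>w \<in> W; y \<in> convex hull (v ` W); z \<in> convex hull (v ` W)\<rbrakk>
    \<Longrightarrow> \<bar>coord v y w - coord v z w\<bar> \<le> M * norm (y - z)"
    using coord_lipschitz[OF v] by blast
  have "inj_on (transition v u) (convex hull (v ` W))"
    if small: "displacement u v < inverse (M + 1)" for u
  proof (rule inj_onI, rule ccontr)
    fix y z assume yz: "y \<in> convex hull (v ` W)" "z \<in> convex hull (v ` W)"
      "transition v u y = transition v u z" "y \<noteq> z"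
    have "z - y = (transition v u y - y) - (transition v u z - z)"
      using yz by simp
    also have "\<dots> = (bary W u (coord v y) - bary W v (coord v y)) -
        (bary W u (coord v z) - bary W v (coord v z))"
      using bary_coord[OF v] yz by (simp add: transition_def)
    also have "\<dots> = (\<Sum>w\<in>W. (coord v y w - coord v z w) *\<^sub>R (u w - v w))"
      by (simp add: bary_def scaleR_diff_right scaleR_diff_left sum_subtractf)
    also have "norm \<dots> \<le> (\<Sum>w\<in>W. M * norm (y - z) * norm (u w - v w))"
    proof (intro sum_norm_le)
      fix w assume "w \<in> W"
      then show "norm ((coord v y w - coord v z w) *\<^sub>R (u w - v w))
          \<le> M * norm (y - z) * norm (u w - v w)"
        using M(2) yz by (auto intro!: mult_right_mono)
    qed
    also have "\<dots> = M * displacement u v * norm (y - z)"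
      by (simp add: displacement_def sum_distrib_left mult_ac)
    finally have "norm (y - z) \<le> M * displacement u v * norm (y - z)"
      by (simp add: norm_minus_commute)
    then have "1 \<le> M * displacement u v"
      using yz by simp
    also have "\<dots> \<le> (M + 1) * displacement u v"
      using displacement_nonneg by (simp add: algebra_simps)
    also have "\<dots> < (M + 1) * inverse (M + 1)"
      using small M by (intro mult_strict_left_mono) auto
    also have "\<dots> = 1" using M by simp
    finally show False by simp
  qed
  then show ?thesis using M by (intro exI[of _ "inverse (M + 1)"]) auto
qed

lemma bary_injI:
  assumes v: "triangulates v" and inj: "inj_on (transition v u) (convex hull (v ` W))"
  shows "inj_on (bary W u) realisation"
proof (rule inj_onI)
  fix \<mu> \<nu> assume *: "\<mu> \<in> realisation" "\<nu> \<in> realisation" "bary W u \<mu> = bary W u \<nu>"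
  then have "transition v u (bary W v \<mu>) = transition v u (bary W v \<nu>)"
    using transition_bary[OF v] by simp
  then have "bary W v \<mu> = bary W v \<nu>"
    using inj * bary_in_hull realisation_weights by (metis inj_onD)
  then show "\<mu> = \<nu>" using coord_bary[OF v] * by metis
qed

lemma bary_image_transition:
  assumes v: "triangulates v"
  shows "bary W u ` realisation = transition v u ` (convex hull (v ` W))"
proof
  show "bary W u ` realisation \<subseteq> transition v u ` (convex hull (v ` W))"
  proof clarify
    fix \<mu> assume "\<mu> \<in> realisation"
    then show "bary W u \<mu> \<in> transition v u ` (convex hull (v ` W))"
      using transition_bary[OF v, of \<mu> u] bary_in_hull[OF realisation_weights, of \<mu> v]
      by (intro image_eqI[of _ _ "bary W v \<mu>"]) simp_all
  qed
  show "transition v u ` (convex hull (v ` W)) \<subseteq> bary W u ` realisation"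
    using coord_realisation[OF v] by (auto simp: transition_def)
qed

lemma triangulates_of_transition:
  assumes "triangulates v" "nondegenerate u"
    and "inj_on (transition v u) (convex hull (v ` W))"
    and "transition v u ` (convex hull (v ` W)) = convex hull (u ` W)"
  shows "triangulates u"
  using assms bary_injI bary_image_transition
  unfolding triangulates_def[of u] bij_betw_def by blast

definition same_maximisers :: "('w \<Rightarrow> 'v::euclidean_space) \<Rightarrow> ('w \<Rightarrow> 'v) \<Rightarrow> bool" where
  "same_maximisers v u \<longleftrightarrow> (\<forall>c. \<forall>w\<in>W.
    (\<forall>x\<in>W. c \<bullet> v x \<le> c \<bullet> v w) \<longleftrightarrow> (\<forall>x\<in>W. c \<bullet> u x \<le> c \<bullet> u w))"

lemma inner_bary: "c \<bullet> bary W v \<mu> = (\<Sum>w\<in>W. \<mu> w * (c \<bullet> v w))"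
  by (simp add: bary_def inner_sum_right)

text \<open>A boundary point maximises some functional that is not constant on the polytope, so its
  coordinates involve maximising vertices only. These stay maximising after the deformation, and
  the functional does not become constant.\<close>

lemma transition_boundary:
  fixes v u :: "'w \<Rightarrow> 'v::euclidean_space"
  assumes v: "triangulates v" and same: "same_maximisers v u"
    and y: "y \<in> convex hull (v ` W)" "y \<notin> rel_interior (convex hull (v ` W))"
  shows "transition v u y \<notin> rel_interior (convex hull (u ` W))"
proof
  let ?P = "convex hull (v ` W)" and ?Q = "convex hull (u ` W)"
  define \<mu> where "\<mu> = coord v y"
  define x where "x = transition v u y"
  assume "transition v u y \<in> rel_interior ?Q"
  then have x: "x \<in> rel_interior ?Q" "x = bary W u \<mu>"
    by (auto simp: x_def transition_def \<mu>_def)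
  have \<mu>: "\<mu> \<in> weights W" "y = bary W v \<mu>"
    using realisation_weights coord_realisation[OF v] bary_coord[OF v] y by (auto simp: \<mu>_def)
  obtain a where a: "\<And>z. z \<in> ?P \<Longrightarrow> a \<bullet> y \<le> a \<bullet> z"
    and strict: "\<And>z. z \<in> rel_interior ?P \<Longrightarrow> a \<bullet> y < a \<bullet> z"
    by (rule supporting_hyperplane_rel_boundary[OF convex_convex_hull y]) (use that in blast)
  define c where "c = - a"
  have "\<forall>w\<in>W. \<mu> w * (a \<bullet> v w - a \<bullet> y) = 0"
  proof -
    have "(\<Sum>w\<in>W. \<mu> w * (a \<bullet> v w - a \<bullet> y)) = a \<bullet> bary W v \<mu> - (\<Sum>w\<in>W. \<mu> w) * (a \<bullet> y)"
      by (simp add: inner_bary right_diff_distrib sum_subtractf sum_distrib_right)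
    also have "\<dots> = 0" using \<mu> by (simp add: weights_def)
    finally have "(\<Sum>w\<in>W. \<mu> w * (a \<bullet> v w - a \<bullet> y)) = 0" .
    moreover have "0 \<le> \<mu> w * (a \<bullet> v w - a \<bullet> y)" if "w \<in> W" for w
      using a[of "v w"] that \<mu> by (auto simp: weights_def hull_inc)
    ultimately show ?thesis
      using sum_nonneg_eq_0_iff[OF finite_W, of "\<lambda>w. \<mu> w * (a \<bullet> v w - a \<bullet> y)"] by blast
  qed
  then have "\<forall>z\<in>W. c \<bullet> v z \<le> c \<bullet> v w" if "w \<in> W" "\<mu> w \<noteq> 0" for w
    using that a by (auto simp: c_def hull_inc)
  then have umax: "\<forall>z\<in>W. c \<bullet> u z \<le> c \<bullet> u w" if "w \<in> W" "\<mu> w \<noteq> 0" for w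
    using same that unfolding same_maximisers_def by blast
  have cx: "c \<bullet> u z \<le> c \<bullet> x" if "z \<in> W" for z
  proof -
    have "c \<bullet> u z = (\<Sum>w\<in>W. \<mu> w * (c \<bullet> u z))"
      using \<mu> by (simp add: weights_def flip: sum_distrib_right)
    also have "\<dots> \<le> (\<Sum>w\<in>W. \<mu> w * (c \<bullet> u w))"
    proof (intro sum_mono)
      fix w assume "w \<in> W"
      then show "\<mu> w * (c \<bullet> u z) \<le> \<mu> w * (c \<bullet> u w)"
        using umax[of w] that \<mu> by (cases "\<mu> w = 0") (auto simp: weights_def intro!: mult_left_mono)
    qed
    finally show ?thesis by (simp add: x(2) inner_bary)
  qed
  have le: "c \<bullet> q \<le> c \<bullet> x" if "q \<in> ?Q" for q
  proof -
    have "u ` W \<subseteq> {q. c \<bullet> q \<le> c \<bullet> x}" using cx by auto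
    then have "?Q \<subseteq> {q. c \<bullet> q \<le> c \<bullet> x}"
      by (intro hull_minimal convex_halfspace_le)
    then show ?thesis using that by auto
  qed
  \<comment> \<open>A functional that attains its maximum in the relative interior is constant.\<close>
  have const: "c \<bullet> u z = c \<bullet> x" if "z \<in> W" for z
  proof -
    have "u z \<in> ?Q" using that by (simp add: hull_inc)
    then obtain e where e: "1 < e" "(1 - e) *\<^sub>R u z + e *\<^sub>R x \<in> ?Q"
      using x(1) convex_rel_interior_iff[OF convex_convex_hull, of "u ` W" x] by blast
    have "(1 - e) * (c \<bullet> u z) + e * (c \<bullet> x) \<le> c \<bullet> x"
      using le[OF e(2)] by (simp add: inner_add_right)
    then have "(e - 1) * (c \<bullet> x - c \<bullet> u z) \<le> 0"
      by (simp add: algebra_simps)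
    then have "c \<bullet> x \<le> c \<bullet> u z"
      using e by (simp add: mult_le_0_iff)
    then show ?thesis using cx[OF that] by simp
  qed
  have le_v: "c \<bullet> v z \<le> c \<bullet> v w" if "z \<in> W" "w \<in> W" for z w
  proof -
    have "\<forall>x\<in>W. c \<bullet> u x \<le> c \<bullet> u w" using const that by simp
    then show ?thesis using same that unfolding same_maximisers_def by blast
  qed
  have eq: "a \<bullet> v z = a \<bullet> v w" if "z \<in> W" "w \<in> W" for z w
    using le_v[OF that] le_v[OF that(2,1)] by (simp add: c_def)
  have const: "a \<bullet> v z = a \<bullet> y" if z: "z \<in> W" for z
  proof -
    have "a \<bullet> y = (\<Sum>w\<in>W. \<mu> w * (a \<bullet> v z))"
      unfolding \<mu>(2) inner_bary by (intro sum.cong refl) (simp add: eq[OF z])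
    also have "\<dots> = a \<bullet> v z"
      using \<mu> by (simp add: weights_def flip: sum_distrib_right)
    finally show ?thesis by simp
  qed
  have "v ` W \<subseteq> {q. a \<bullet> q = a \<bullet> y}" using const by auto
  then have "?P \<subseteq> {q. a \<bullet> q = a \<bullet> y}"
    by (intro hull_minimal convex_hyperplane)
  moreover obtain z where "z \<in> rel_interior ?P"
    using y rel_interior_eq_empty[OF convex_convex_hull, of "v ` W"] by auto
  ultimately show False
    using strict[of z] rel_interior_subset[of ?P] by auto
qed

text \<open>A nearby configuration with the same facial structure: the transition map is injective, and
  onto because it preserves the boundary.\<close>

lemma triangulates_nearby:
  fixes v :: "'w \<Rightarrow> 'v::euclidean_space"
  assumes v: "triangulates v"
  shows "\<exists>e>0. \<forall>u. displacement u v < e \<and> nondegenerate u \<and> same_maximisers v u \<and>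
    aff_dim (u ` W) = aff_dim (v ` W) \<longrightarrow> triangulates u"
proof -
  obtain e where e: "0 < e" "\<And>u. displacement u v < e \<Longrightarrow> inj_on (transition v u) (convex hull (v ` W))"
    using transition_injective[OF v] by blast
  have "triangulates u" if u: "displacement u v < e" "nondegenerate u" "same_maximisers v u"
    "aff_dim (u ` W) = aff_dim (v ` W)" for u
  proof (rule triangulates_of_transition[OF v u(2) e(2)[OF u(1)]])
    show "transition v u ` (convex hull (v ` W)) = convex hull (u ` W)"
    proof (cases "W = {}")
      case False
      then show ?thesis
        using compact_hull continuous_transition[OF v] e(2)[OF u(1)] transition_in_hull[OF v]
          transition_boundary[OF v u(3)] u(4)
        by (intro boundary_preserving_injection_onto)
          (auto simp: aff_dim_convex_hull compact_imp_closed)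
    qed simp
  qed
  then show ?thesis using e by blast
qed

text \<open>A transition map to a limit configuration is a limit of embeddings onto convex sets, and its
  fibres are finite, as each simplex contains at most one point of a fibre. Hence it is
  injective; it is onto because its image is compact.\<close>

lemma triangulates_limit:
  fixes v :: "'w \<Rightarrow> 'v::euclidean_space"
  assumes nd: "nondegenerate v"
    and approx: "\<And>e. 0 < e \<Longrightarrow> \<exists>u. triangulates u \<and> displacement u v < e"
  shows "triangulates v"
proof -
  obtain base where base: "triangulates (base :: 'w \<Rightarrow> 'v)"
    using approx[of 1] by auto
  let ?P = "convex hull (base ` W)" and ?f = "transition base v"
  have close: "dist (transition base u y) (?f y) \<le> displacement u v" if "y \<in> ?P" for u y
    unfolding transition_def dist_norm
    using bary_displacement realisation_weights coord_realisation[OF base that] by blast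
  have onto: "transition base u ` ?P = convex hull (u ` W)" if "triangulates u" for u :: "'w \<Rightarrow> 'v"
    using that bary_image_transition[OF base, of u] by (simp add: triangulates_def bij_betw_def)
  have cont: "continuous_on ?P ?f" by (rule continuous_transition[OF base])
  show ?thesis
  proof (rule triangulates_of_transition[OF base nd])
    show "inj_on ?f ?P"
    proof (rule limit_of_convex_embeddings_inj[OF compact_hull cont])
      fix x
      have "finite {\<mu> \<in> weights (S i). bary W v \<mu> = x}" if "i \<in> I" for i
      proof (rule finite_subset)
        show "{\<mu> \<in> weights (S i). bary W v \<mu> = x} \<subseteq> {inv_into (weights (S i)) (bary W v) x}"
          using inv_into_f_f[OF nondegenerate_inj[OF nd that]] by auto
      qed simp
      then have "finite (\<Union>i\<in>I. {\<mu> \<in> weights (S i). bary W v \<mu> = x})"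
        using finite_I by blast
      then have "finite (bary W base ` (\<Union>i\<in>I. {\<mu> \<in> weights (S i). bary W v \<mu> = x}))"
        by (rule finite_imageI)
      moreover have "{y \<in> ?P. ?f y = x} \<subseteq> bary W base ` (\<Union>i\<in>I. {\<mu> \<in> weights (S i). bary W v \<mu> = x})"
      proof clarify
        fix y assume y: "y \<in> ?P" "x = ?f y"
        show "y \<in> bary W base ` (\<Union>i\<in>I. {\<mu> \<in> weights (S i). bary W v \<mu> = ?f y})"
          using coord_realisation[OF base y(1)] bary_coord[OF base y(1)]
          by (intro image_eqI[of _ _ "coord base y"]) (auto simp: realisation_def transition_def)
      qed
      ultimately show "finite {y \<in> ?P. ?f y = x}"
        by (rule rev_finite_subset)
    next
      fix e :: real assume "0 < e"
      then obtain u where u: "triangulates u" "displacement u v < e" using approx by blast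
      have "inj_on (transition base u) ?P"
      proof (rule inj_onI)
        fix y z assume *: "y \<in> ?P" "z \<in> ?P" "transition base u y = transition base u z"
        then have "coord base y = coord base z"
          using u(1) coord_realisation[OF base]
          unfolding transition_def triangulates_def bij_betw_def by (metis inj_onD)
        then show "y = z" using bary_coord[OF base] * by metis
      qed
      moreover have "convex (transition base u ` ?P)"
        using onto[OF u(1)] by simp
      moreover have "\<forall>y\<in>?P. dist (transition base u y) (?f y) < e"
        using close u by (meson le_less_trans)
      ultimately show "\<exists>g. continuous_on ?P g \<and> inj_on g ?P \<and> convex (g ` ?P) \<and>
          (\<forall>y\<in>?P. dist (g y) (?f y) < e)"
        using continuous_transition[OF base] by blast
    qed
    show "?f ` ?P = convex hull (v ` W)"
    proof
      show "?f ` ?P \<subseteq> convex hull (v ` W)"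
        using transition_in_hull[OF base] by blast
      have "closed (?f ` ?P)"
        using compact_continuous_image[OF cont compact_hull] by (rule compact_imp_closed)
      moreover have "x \<in> closure (?f ` ?P)" if x: "x \<in> convex hull (v ` W)" for x
        unfolding closure_approachable
      proof clarify
        fix e :: real assume "0 < e"
        then obtain u where u: "triangulates u" "displacement u v < e / 2"
          using approx[of "e / 2"] by auto
        obtain \<mu> where \<mu>: "\<mu> \<in> weights W" "x = bary W v \<mu>"
          using hull_as_bary[OF x] by blast
        obtain y where y: "y \<in> ?P" "bary W u \<mu> = transition base u y"
          using onto[OF u(1)] bary_in_hull[OF \<mu>(1), of u] by (metis imageE)
        have "dist (bary W u \<mu>) x \<le> displacement u v"
          using bary_displacement[OF \<mu>(1)] \<mu> by (simp add: dist_norm)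
        then have "dist (?f y) x < e"
          using close[OF y(1), of u] y(2) u(2) dist_triangle2[of "?f y" x "transition base u y"]
          by (simp add: dist_commute)
        then show "\<exists>z\<in>?f ` ?P. dist z x < e" using y by auto
      qed
      ultimately show "convex hull (v ` W) \<subseteq> ?f ` ?P"
        using closure_closed by blast
    qed
  qed
qed

text \<open>For an injective labelling, two faces that are equal as sets have the same labels, because the
  vertices of a simplex are determined by it.\<close>

lemma triangulates_iff_triangulation:
  fixes v :: "'w \<Rightarrow> 'v::euclidean_space"
  assumes inj: "inj_on v W" and nd: "nondegenerate v"
  shows "triangulates v \<longleftrightarrow> triangulation ((\<lambda>i. convex hull (v ` S i)) ` I) \<and>
    convex hull (v ` W) = (\<Union>i\<in>I. convex hull (v ` S i))"
proof -
  have image: "bary W v ` realisation = (\<Union>i\<in>I. convex hull (v ` S i))"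
    unfolding realisation_def image_UN by (intro SUP_cong refl bary_S_image)
  have indep: "\<not> affine_dependent (v ` S i)" if "i \<in> I" for i
    using nd that by (simp add: nondegenerate_def)
  have "triangulation ((\<lambda>i. convex hull (v ` S i)) ` I)" if inj_bary: "inj_on (bary W v) realisation"
    unfolding triangulation_def
  proof (intro conjI allI impI ballI)
    fix T assume "T \<in> (\<lambda>i. convex hull (v ` S i)) ` I"
    then obtain i where i: "i \<in> I" "T = convex hull (v ` S i)" by auto
    then show "\<exists>n. n simplex T"
      unfolding simplex_def using indep
      by (intro exI[of _ "int (card (v ` S i)) - 1"] exI[of _ "v ` S i"]) auto
  next
    fix T T' assume "T \<in> (\<lambda>i. convex hull (v ` S i)) ` I \<and> T' \<in> (\<lambda>i. convex hull (v ` S i)) ` I"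
    then obtain i j where i: "i \<in> I" "T = convex hull (v ` S i)"
      and j: "j \<in> I" "T' = convex hull (v ` S j)" by auto
    have "T \<inter> T' \<subseteq> convex hull (v ` (S i \<inter> S j))"
    proof
      fix x assume "x \<in> T \<inter> T'"
      then have "x \<in> bary W v ` weights (S i)" "x \<in> bary W v ` weights (S j)"
        by (auto simp: i j bary_S_image)
      then obtain \<mu> \<nu> where \<mu>: "\<mu> \<in> weights (S i)" "x = bary W v \<mu>"
        and \<nu>: "\<nu> \<in> weights (S j)" "x = bary W v \<nu>" by auto
      have "\<mu> = \<nu>"
        using inj_onD[OF inj_bary, of \<mu> \<nu>] \<mu> \<nu> i j by (auto simp: realisation_def)
      then have "\<mu> \<in> weights (S i \<inter> S j)"
        using weights_Int[OF finite_S[OF i(1)] \<mu>(1)] \<nu>(1) by simp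
      moreover have fin: "finite (S i \<inter> S j)" using finite_S[OF i(1)] by simp
      moreover have "x = bary (S i \<inter> S j) v \<mu>"
        unfolding \<mu>(2) using S_subset[OF i(1)] calculation(1)
        by (intro bary_extend finite_W) auto
      ultimately show "x \<in> convex hull (v ` (S i \<inter> S j))"
        using bary_weights[OF fin, of v] by auto
    qed
    moreover have "convex hull (v ` (S i \<inter> S j)) \<subseteq> T \<inter> T'"
      unfolding i j by (intro Int_greatest hull_mono image_mono) auto
    ultimately have "T \<inter> T' = convex hull (v ` (S i \<inter> S j))" by (rule equalityI)
    moreover have "v ` (S i \<inter> S j) \<subseteq> v ` S i" by auto
    ultimately show "(T \<inter> T') face_of T"
      unfolding i(2) face_of_convex_hull_affine_independent[OF indep[OF i(1)]] by blast
  qed (use finite_I in simp)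
  moreover have "inj_on (bary W v) realisation"
    if tri: "triangulation ((\<lambda>i. convex hull (v ` S i)) ` I)"
  proof (rule inj_onI)
    fix \<mu> \<nu> assume "\<mu> \<in> realisation" "\<nu> \<in> realisation" and eq: "bary W v \<mu> = bary W v \<nu>"
    then obtain i j where i: "i \<in> I" "\<mu> \<in> weights (S i)" and j: "j \<in> I" "\<nu> \<in> weights (S j)"
      by (auto simp: realisation_def)
    let ?T = "convex hull (v ` S i)" and ?T' = "convex hull (v ` S j)"
    have "(?T \<inter> ?T') face_of ?T" "(?T' \<inter> ?T) face_of ?T'"
      using tri i j unfolding triangulation_def by blast+
    then obtain C D where C: "C \<subseteq> v ` S i" "?T \<inter> ?T' = convex hull C"
      and D: "D \<subseteq> v ` S j" "?T' \<inter> ?T = convex hull D"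
      unfolding face_of_convex_hull_affine_independent[OF indep[OF i(1)]]
        face_of_convex_hull_affine_independent[OF indep[OF j(1)]] by blast
    have "\<not> affine_dependent C" "\<not> affine_dependent D"
      using C D affine_dependent_subset indep i j by blast+
    then have "C = {x. x extreme_point_of (convex hull C)}" "D = {x. x extreme_point_of (convex hull D)}"
      by (auto simp: extreme_point_of_convex_hull_affine_independent)
    moreover have "convex hull C = convex hull D" using C D by (metis Int_commute)
    ultimately have "C = D" by simp
    then have "C \<subseteq> v ` (S i \<inter> S j)"
      using C D inj_on_image_Int[OF inj S_subset[OF i(1)] S_subset[OF j(1)]] by auto
    moreover have "bary W v \<mu> \<in> convex hull C"
      using imageI[OF i(2), of "bary W v"] imageI[OF j(2), of "bary W v"] eq
      by (simp add: bary_S_image i j flip: C(2))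
    ultimately have "bary W v \<mu> \<in> convex hull (v ` (S i \<inter> S j))"
      using hull_mono by blast
    moreover have fin: "finite (S i \<inter> S j)" using finite_S[OF i(1)] by simp
    ultimately have "bary W v \<mu> \<in> bary (S i \<inter> S j) v ` weights (S i \<inter> S j)"
      using bary_weights[OF fin, of v] by simp
    then obtain \<rho> where \<rho>: "\<rho> \<in> weights (S i \<inter> S j)" "bary (S i \<inter> S j) v \<rho> = bary W v \<mu>"
      by auto
    have \<rho>ij: "\<rho> \<in> weights (S i)" "\<rho> \<in> weights (S j)"
      using weights_mono[OF finite_S[OF i(1)] _ \<rho>(1)] weights_mono[OF finite_S[OF j(1)] _ \<rho>(1)] by auto
    have "S i \<inter> S j \<subseteq> W" using S_subset[OF i(1)] by auto
    then have "bary W v \<rho> = bary W v \<mu>"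
      using bary_extend[OF finite_W _ \<rho>(1), of v] \<rho>(2) by simp
    then have "\<rho> = \<mu>" "\<rho> = \<nu>"
      using inj_onD[OF nondegenerate_inj[OF nd i(1)] _ \<rho>ij(1) i(2)]
        inj_onD[OF nondegenerate_inj[OF nd j(1)] _ \<rho>ij(2) j(2)] eq by auto
    then show "\<mu> = \<nu>" by simp
  qed
  ultimately show ?thesis
    using nd image unfolding triangulates_def bij_betw_def by metis
qed

end

section \<open>Persistence of triangulations\<close>

text \<open>The vertices of a simplex are among the points that it is the hull of, so with the right
  number of points all of them are vertices.\<close>

lemma simplex_hull_labels:
  fixes v :: "'w \<Rightarrow> 'v::euclidean_space"
  assumes A: "finite A" "int (card A) = n + 1" and n: "n simplex (convex hull (v ` A))"
  shows "inj_on v A \<and> \<not> affine_dependent (v ` A)"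
proof -
  obtain C where C: "\<not> affine_dependent C" "int (card C) = n + 1" "convex hull (v ` A) = convex hull C"
    using n unfolding simplex_def by blast
  have "C \<subseteq> v ` A"
  proof
    fix x assume "x \<in> C"
    then have "x extreme_point_of (convex hull (v ` A))"
      using extreme_point_of_convex_hull_affine_independent[OF C(1)] C(3) by simp
    then show "x \<in> v ` A" by (rule extreme_point_of_convex_hull)
  qed
  moreover have "card (v ` A) \<le> card C"
    using card_image_le[OF A(1), of v] A C by simp
  ultimately have "C = v ` A"
    using A by (intro card_seteq) auto
  then show ?thesis
    using C A eq_card_imp_inj_on[OF A(1), of v] by auto
qed

lemma a_simplex_labels:
  assumes "finite W" "a_simplex W b A"
  shows "inj_on (\<lambda>w. w b) A \<and> \<not> affine_dependent ((\<lambda>w. w b) ` A)"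
  using assms finite_subset unfolding a_simplex_def orbit_points_def
  by (intro simplex_hull_labels) auto

text \<open>The configurations \<open>w \<mapsto> w x\<close>, for \<open>x\<close> in the chamber, have the same maximising
  labels and dimension and depend isometrically on \<open>x\<close> up to a factor, so the good points form an
  open and closed subset of the connected chamber.\<close>

lemma persistent_triangulation_of_simplices:
  fixes W :: "('v::euclidean_space \<Rightarrow> 'v) set"
  assumes W: "finite_reflection_group W \<Phi>" and B: "open_chamber \<Phi> B" and a: "a \<in> B"
    and I: "finite I" and tri: "a_triangulation W a I S"
    and simplices: "\<forall>i\<in>I. persistent_simplex W B (S i)"
    and b: "b \<in> B"
  shows "a_triangulation W b I S"
proof -
  have simp_at: "a_simplex W x (S i)" if "x \<in> B" "i \<in> I" for x i
    using simplices that unfolding persistent_simplex_def by blast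
  interpret label_complex W I S
    using W I simp_at[OF a]
    by unfold_locales (auto simp: finite_reflection_group_def a_simplex_def)
  define vertices where "vertices x = (\<lambda>w :: 'v \<Rightarrow> 'v. w x)" for x
  have nd: "nondegenerate (vertices x)" if "x \<in> B" for x
    using a_simplex_labels[OF finite_W simp_at[OF that]]
    unfolding nondegenerate_def vertices_def by blast
  have inj: "inj_on (vertices x) W" if "x \<in> B" for x
    using chamber_action_free[OF W B that] by (auto simp: vertices_def inj_on_def)
  have iff: "a_triangulation W x I S \<longleftrightarrow> triangulates (vertices x)" if x: "x \<in> B" for x
    using triangulates_iff_triangulation[OF inj[OF x] nd[OF x]] simp_at[OF x]
    by (simp add: a_triangulation_def permutohedron_def orbit_points_def vertices_def)
  have nonempty: "W \<noteq> {}" using id_in_group[OF W] by auto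
  then have "I \<noteq> {}"
    using tri by (auto simp: a_triangulation_def permutohedron_def orbit_points_def)
  then obtain i where i: "i \<in> I" by auto
  have dim: "aff_dim (vertices x ` W) = int (card (S i)) - 1" if "x \<in> B" for x
    using simp_at[OF that i]
    by (simp add: a_simplex_def permutohedron_def orbit_points_def vertices_def aff_dim_convex_hull)
  have same: "same_maximisers (vertices x) (vertices y)" if "x \<in> B" "y \<in> B" for x y
    unfolding same_maximisers_def vertices_def
    using chamber_maximal_transfer[OF W B] that by blast
  have disp: "displacement (vertices x) (vertices y) = real (card W) * dist x y" for x y
  proof -
    have "norm (w x - w y) = dist x y" if "w \<in> W" for w
      using group_element_orthogonal[OF W that]
      by (simp add: orthogonal_transformation_isometry flip: dist_norm)
    then show ?thesis by (simp add: displacement_def vertices_def)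
  qed
  have card: "0 < real (card W)" using nonempty finite_W by (simp add: card_gt_0_iff)
  define G where "G = {x \<in> B. triangulates (vertices x)}"
  have "openin (top_of_set B) G"
    unfolding openin_contains_ball
  proof (intro conjI ballI)
    fix x assume x: "x \<in> G"
    then obtain e where e: "0 < e" "\<And>u. displacement u (vertices x) < e \<and> nondegenerate u \<and>
        same_maximisers (vertices x) u \<and> aff_dim (u ` W) = aff_dim (vertices x ` W) \<Longrightarrow> triangulates u"
      using triangulates_nearby[of "vertices x"] by (auto simp: G_def)
    have "ball x (e / real (card W)) \<inter> B \<subseteq> G"
    proof
      fix y assume y: "y \<in> ball x (e / real (card W)) \<inter> B"
      then have "displacement (vertices y) (vertices x) < e"
        using card by (simp add: disp dist_commute pos_less_divide_eq mult.commute)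
      then show "y \<in> G"
        using e(2)[of "vertices y"] nd same dim x y by (auto simp: G_def)
    qed
    then show "\<exists>e>0. ball x e \<inter> B \<subseteq> G"
      using e card by (intro exI[of _ "e / real (card W)"]) auto
  qed (auto simp: G_def)
  moreover have "closedin (top_of_set B) G"
    unfolding closedin_limpt
  proof (intro conjI allI impI)
    fix x assume x: "x islimpt G \<and> x \<in> B"
    have "triangulates (vertices x)"
    proof (rule triangulates_limit)
      show "nondegenerate (vertices x)" using nd x by blast
      fix e :: real assume "0 < e"
      then have "0 < e / real (card W)" using card by simp
      then obtain y where y: "y \<in> G" "dist y x < e / real (card W)"
        using x unfolding islimpt_approachable by blast
      then have "displacement (vertices y) (vertices x) < e"
        using card by (simp add: disp pos_less_divide_eq mult.commute)
      then show "\<exists>u. triangulates u \<and> displacement u (vertices x) < e"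
        using y by (auto simp: G_def)
    qed
    then show "x \<in> G" using x by (simp add: G_def)
  qed (auto simp: G_def)
  moreover have "a \<in> G" using a tri iff[OF a] by (simp add: G_def)
  moreover have "connected B"
    using B in_components_connected unfolding open_chamber_def by blast
  ultimately have "G = B"
    unfolding connected_clopen by blast
  then show ?thesis using b iff[OF b] by (auto simp: G_def)
qed

theorem theorem5p1:
  fixes W :: "('v::euclidean_space \<Rightarrow> 'v) set" and \<Phi> B :: "'v set" and a :: 'v
    and p :: nat and S :: "nat \<Rightarrow> ('v \<Rightarrow> 'v) set"
  assumes "finite_reflection_group W \<Phi>"
    and "open_chamber \<Phi> B"
    and "a \<in> B"
    and "a_triangulation W a {1..p} S"
  shows "persistent_triangulation W B {1..p} S \<longleftrightarrow> (\<forall>i\<in>{1..p}. persistent_simplex W B (S i))"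
  using persistent_triangulation_of_simplices[OF assms(1-3) _ assms(4)]
  unfolding persistent_triangulation_def by auto

end
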